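(* 1) The set $\Sigma$ of $U$-controllable pairs is open and everywhere dense in $\mathcal O\times\mathcal O$. 2) The set of almost $U$-controllable operators is open and everywhere dense in $\mathcal O$.
   Context: $\mathcal H=\mathbb C^N$, $N>1$, with the standard Hermitian inner product. $\mathcal O$ is the real vector space of Hermitian operators on $\mathcal H$ (with its Euclidean topology). For $H_1,H_2\in\mathcal O$ let $U_k^t=e^{-itH_k}$. For $n\ge1$ and $s_1,\dots,s_n\ge0$ let $J_n(s_1,\dots,s_n)=U_{k_n}^{s_n}\cdots U_{k_2}^{s_2}U_{1}^{s_1}$, where $k_j=1$ for odd $j$ and $k_j=2$ for even $j$, and $\mathcal J_n(H_1,H_2)=\{J_n(s_1,\dots,s_n): s_j\ge0\}$. The pair $(H_1,H_2)$ is $U$-controllable if $\mathcal J_n(H_1,H_2)=U(N)$ for some $n$. $\Sigma\subset\mathcal O\times\mathcal O$ is the set of $U$-controllable pairs; for $H_1\in\mathcal O$, $\Sigma(H_1)=\{H_2\in\mathcal O:(H_1,H_2)\in\Sigma\}$. $H_1$ is called almost $U$-controllable if $\Sigma(H_1)$ is open and everywhere dense in $\mathcal O$. *)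

theory Defs
  imports "HOL-Analysis.Analysis"
begin

text \<open>Operators on C^N are represented as N x N complex matrices, N = CARD('n).\<close>

type_synonym 'n cmat = "complex ^ 'n ^ 'n"

definition adjoint :: "'n::finite cmat \<Rightarrow> 'n cmat" where
  "adjoint A = (\<chi> i j. cnj (A $ j $ i))"

definition hermitian :: "'n::finite cmat \<Rightarrow> bool" where
  "hermitian A \<longleftrightarrow> adjoint A = A"

definition herm_ops :: "'n::finite cmat set" where
  "herm_ops = {A. hermitian A}"

definition unitary_group :: "'n::finite cmat set" where
  "unitary_group = {U. U ** adjoint U = mat 1 \<and> adjoint U ** U = mat 1}"

definition cscale :: "complex \<Rightarrow> 'n::finite cmat \<Rightarrow> 'n cmat" where
  "cscale c A = (\<chi> i j. c * A $ i $ j)"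

primrec mpow :: "'n::finite cmat \<Rightarrow> nat \<Rightarrow> 'n cmat" where
  "mpow A 0 = mat 1"
| "mpow A (Suc k) = A ** mpow A k"

definition mexp :: "'n::finite cmat \<Rightarrow> 'n cmat" where
  "mexp A = (\<Sum>k. (1 / fact k) *\<^sub>R mpow A k)"

definition evol :: "'n::finite cmat \<Rightarrow> real \<Rightarrow> 'n cmat" where
  "evol H t = mexp (cscale (- \<i> * complex_of_real t) H)"

primrec Jprod :: "'n::finite cmat \<Rightarrow> 'n cmat \<Rightarrow> nat \<Rightarrow> (nat \<Rightarrow> real) \<Rightarrow> 'n cmat" where
  "Jprod H1 H2 0 s = mat 1"
| "Jprod H1 H2 (Suc m) s =
     evol (if odd (Suc m) then H1 else H2) (s (Suc m)) ** Jprod H1 H2 m s"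

definition Jset :: "nat \<Rightarrow> 'n::finite cmat \<Rightarrow> 'n cmat \<Rightarrow> 'n cmat set" where
  "Jset n H1 H2 = {Jprod H1 H2 n s | s. \<forall>j\<in>{1..n}. s j \<ge> 0}"

definition U_controllable :: "'n::finite cmat \<Rightarrow> 'n cmat \<Rightarrow> bool" where
  "U_controllable H1 H2 \<longleftrightarrow> (\<exists>n\<ge>1. Jset n H1 H2 = unitary_group)"

definition Sigma_ctrl :: "('n::finite cmat \<times> 'n cmat) set" where
  "Sigma_ctrl = {(H1, H2). H1 \<in> herm_ops \<and> H2 \<in> herm_ops \<and> U_controllable H1 H2}"

definition Sigma_of :: "'n::finite cmat \<Rightarrow> 'n cmat set" where
  "Sigma_of H1 = {H2 \<in> herm_ops. (H1, H2) \<in> Sigma_ctrl}"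

definition almost_U_controllable :: "'n::finite cmat \<Rightarrow> bool" where
  "almost_U_controllable H1 \<longleftrightarrow>
     openin (top_of_set herm_ops) (Sigma_of H1) \<and> herm_ops \<subseteq> closure (Sigma_of H1)"

end

theory Submission
  imports Defs "HOL-Computational_Algebra.Polynomial"
begin

text \<open>Controllability of a Hermitian pair is equivalent to the rank condition that the iterated
  commutators of \<open>H1\<close> and \<open>H2\<close> span all complex matrices over the complex numbers. It is the
  nonvanishing of a polynomial in the entries, hence open, and it persists at arbitrarily small
  parameters along any segment towards a pair that satisfies it. Consequently \<open>H1\<close> is almost
  controllable iff some \<open>H2\<close> completes it to a controllable pair, so that part 2 is about the
  projection of \<open>\<Sigma>\<close>.

  Necessity: if all unitaries are reachable, the span of the iterated commutators is invariant under
  conjugation by every unitary, so it is an ideal of \<open>gl(N)\<close>; it contains a nonscalar matrix and,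
  since \<open>det\<close> is not identically 1 on \<open>U(N)\<close>, a matrix of nonzero trace, so it is everything.

  Sufficiency: the operators \<open>P\<^sup>* H\<^sub>k P\<close> with \<open>P\<close> reachable span all Hermitian operators, so a
  product of the conjugated evolutions \<open>P\<^sup>* exp (- i t H\<^sub>k) P\<close> is a submersion at the identity.
  Reachable operators approximate the inverses occurring in it, because powers of a unitary recur,
  and by Brouwer's theorem the approximation still covers a neighbourhood of the identity. Such a
  neighbourhood generates \<open>U(N)\<close>, in boundedly many steps by compactness.\<close>

section \<open>Complex matrices and the exponential\<close>

lemma cscale_nth [simp]: "cscale c A $ i $ j = c * A $ i $ j"
  by (simp add: cscale_def)

lemma adjoint_nth [simp]: "adjoint A $ i $ j = cnj (A $ j $ i)"
  by (simp add: adjoint_def)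

lemma mat_eqI:
  fixes A B :: "'n::finite cmat"
  assumes "\<And>i j. A $ i $ j = B $ i $ j"
  shows "A = B"
  using assms by (simp add: vec_eq_iff)

lemma cscale_cscale [simp]: "cscale c (cscale d A) = cscale (c * d) A"
  by (intro mat_eqI) (simp add: mult.assoc)

lemma cscale_one [simp]: "cscale 1 A = A"
  by (intro mat_eqI) simp

lemma cscale_zero [simp]: "cscale 0 A = 0" "cscale c 0 = 0"
  by (intro mat_eqI; simp)+

lemma scaleR_eq_cscale: "r *\<^sub>R A = cscale (of_real r) A" for A :: "'n::finite cmat"
  by (intro mat_eqI) (simp add: scaleR_conv_of_real[where 'a = complex])

lemma cscale_uminus [simp]: "cscale (- c) A = - cscale c A" "cscale c (- A) = - cscale c A"
  by (intro mat_eqI; simp)+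

lemma cscale_add: "cscale c (A + B) = cscale c A + cscale c B"
  and cscale_add_left: "cscale (c + d) A = cscale c A + cscale d A"
  and cscale_diff: "cscale c (A - B) = cscale c A - cscale c B"
  by (intro mat_eqI; simp add: algebra_simps)+

lemma cscale_sum: "cscale c (\<Sum>x\<in>I. f x) = (\<Sum>x\<in>I. cscale c (f x))"
  by (induction I rule: infinite_finite_induct) (simp_all add: cscale_add)

lemma cscale_scaleR: "cscale c (r *\<^sub>R A) = r *\<^sub>R cscale c A"
  by (intro mat_eqI) simp

lemma cscale_mult_left [simp]: "cscale c A ** B = cscale c (A ** B)"
  and cscale_mult_right [simp]: "A ** cscale c B = cscale c (A ** B)"
  by (intro mat_eqI; simp add: matrix_matrix_mult_def sum_distrib_left mult.assoc mult.left_commute)+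

lemma scaleR_mult_left [simp]: "(r *\<^sub>R A) ** B = r *\<^sub>R (A ** B)"
  and scaleR_mult_right [simp]: "A ** (r *\<^sub>R B) = r *\<^sub>R (A ** B)" for A B :: "'n::finite cmat"
  by (simp_all add: scaleR_eq_cscale[of r A] scaleR_eq_cscale[of r B] scaleR_eq_cscale[of r "A ** B"])

lemma uminus_mult_left [simp]: "(- A) ** B = - (A ** B)"
  and uminus_mult_right [simp]: "A ** (- B) = - (A ** B)" for A B :: "'n::finite cmat"
  using cscale_mult_left[of "-1" A B] cscale_mult_right[of A "-1" B] by simp_all

lemma matrix_add_rdistrib: "(A + B) ** C = A ** C + B ** C" for A B C :: "'n::finite cmat"
  by (intro mat_eqI) (simp add: matrix_matrix_mult_def sum.distrib algebra_simps)

lemma mult_diff_left: "(A - B) ** C = A ** C - B ** C"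
  and mult_diff_right: "C ** (A - B) = C ** A - C ** B" for A B C :: "'n::finite cmat"
  by (intro mat_eqI; simp add: matrix_matrix_mult_def sum_subtractf algebra_simps)+

lemma cmat_mult_zero_left [simp]: "0 ** A = 0"
  and cmat_mult_zero_right [simp]: "A ** 0 = 0" for A :: "'n::finite cmat"
  by (simp_all add: vec_eq_iff matrix_matrix_mult_def)

lemma adjoint_adjoint [simp]: "adjoint (adjoint A) = A"
  by (intro mat_eqI) simp

lemma adjoint_add: "adjoint (A + B) = adjoint A + adjoint B"
  and adjoint_diff: "adjoint (A - B) = adjoint A - adjoint B"
  and adjoint_uminus [simp]: "adjoint (- A) = - adjoint A"
  and adjoint_cscale [simp]: "adjoint (cscale c A) = cscale (cnj c) (adjoint A)"
  and adjoint_scaleR [simp]: "adjoint (r *\<^sub>R A) = r *\<^sub>R adjoint A"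
  and adjoint_zero [simp]: "adjoint 0 = 0"
  and adjoint_one [simp]: "adjoint (mat 1) = mat 1"
  by (intro mat_eqI; auto simp: mat_def)+

lemma adjoint_mult: "adjoint (A ** B) = adjoint B ** adjoint A"
  by (intro mat_eqI) (simp add: matrix_matrix_mult_def mult.commute)

lemma inner_cmat: "inner A B = Re (\<Sum>i\<in>UNIV. \<Sum>j\<in>UNIV. cnj (A $ i $ j) * B $ i $ j)"
  for A B :: "'n::finite cmat"
  by (simp add: inner_vec_def inner_complex_def)

text \<open>\<open>inner A B\<close> is the real part of the trace of \<open>adjoint A ** B\<close>,
  so both facts are trace identities. They make multiplication by a unitary an isometry.\<close>

lemma inner_mult_left: "inner (A ** B) C = inner B (adjoint A ** C)"
  and inner_mult_right: "inner (B ** A) C = inner B (C ** adjoint A)"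
  for A B C :: "'n::finite cmat"
proof -
  have "(\<Sum>i\<in>UNIV. \<Sum>j\<in>UNIV. cnj ((A ** B) $ i $ j) * C $ i $ j) =
        (\<Sum>i\<in>UNIV. \<Sum>j\<in>UNIV. \<Sum>k\<in>UNIV. cnj (A $ i $ k) * cnj (B $ k $ j) * C $ i $ j)"
    by (simp add: matrix_matrix_mult_def sum_distrib_right)
  also have "\<dots> = (\<Sum>j\<in>UNIV. \<Sum>i\<in>UNIV. \<Sum>k\<in>UNIV. cnj (A $ i $ k) * cnj (B $ k $ j) * C $ i $ j)"
    by (rule sum.swap)
  also have "\<dots> = (\<Sum>j\<in>UNIV. \<Sum>k\<in>UNIV. \<Sum>i\<in>UNIV. cnj (A $ i $ k) * cnj (B $ k $ j) * C $ i $ j)"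
    by (rule sum.cong[OF refl sum.swap])
  also have "\<dots> = (\<Sum>k\<in>UNIV. \<Sum>j\<in>UNIV. \<Sum>i\<in>UNIV. cnj (A $ i $ k) * cnj (B $ k $ j) * C $ i $ j)"
    by (rule sum.swap)
  also have "\<dots> = (\<Sum>k\<in>UNIV. \<Sum>j\<in>UNIV. \<Sum>i\<in>UNIV. cnj (B $ k $ j) * (cnj (A $ i $ k) * C $ i $ j))"
    by (intro sum.cong refl) (simp only: mult_ac)
  also have "\<dots> = (\<Sum>k\<in>UNIV. \<Sum>j\<in>UNIV. cnj (B $ k $ j) * (adjoint A ** C) $ k $ j)"
    by (simp add: matrix_matrix_mult_def sum_distrib_left)
  finally show "inner (A ** B) C = inner B (adjoint A ** C)"
    unfolding inner_cmat by (rule arg_cong)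
  have "(\<Sum>i\<in>UNIV. \<Sum>j\<in>UNIV. cnj ((B ** A) $ i $ j) * C $ i $ j) =
        (\<Sum>i\<in>UNIV. \<Sum>j\<in>UNIV. \<Sum>k\<in>UNIV. cnj (B $ i $ k) * cnj (A $ k $ j) * C $ i $ j)"
    by (simp add: matrix_matrix_mult_def sum_distrib_right)
  also have "\<dots> = (\<Sum>i\<in>UNIV. \<Sum>k\<in>UNIV. \<Sum>j\<in>UNIV. cnj (B $ i $ k) * cnj (A $ k $ j) * C $ i $ j)"
    by (rule sum.cong[OF refl sum.swap])
  also have "\<dots> = (\<Sum>i\<in>UNIV. \<Sum>k\<in>UNIV. \<Sum>j\<in>UNIV. cnj (B $ i $ k) * (C $ i $ j * cnj (A $ k $ j)))"
    by (intro sum.cong refl) (simp only: mult_ac)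
  also have "\<dots> = (\<Sum>i\<in>UNIV. \<Sum>k\<in>UNIV. cnj (B $ i $ k) * (C ** adjoint A) $ i $ k)"
    by (simp add: matrix_matrix_mult_def sum_distrib_left)
  finally show "inner (B ** A) C = inner B (C ** adjoint A)"
    unfolding inner_cmat by (rule arg_cong)
qed

lemma bounded_bilinear_mult: "bounded_bilinear ((**) :: 'n::finite cmat \<Rightarrow> 'n cmat \<Rightarrow> 'n cmat)"
  unfolding bilinear_conv_bounded_bilinear[symmetric] bilinear_def
  by (auto intro!: linearI simp: matrix_add_ldistrib matrix_add_rdistrib)

lemma bounded_linear_cscale: "bounded_linear (cscale c :: 'n::finite cmat \<Rightarrow> _)"
  unfolding linear_conv_bounded_linear[symmetric]
  by (auto intro!: linearI simp: cscale_add cscale_scaleR)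

lemma bounded_linear_adjoint: "bounded_linear (adjoint :: 'n::finite cmat \<Rightarrow> _)"
  unfolding linear_conv_bounded_linear[symmetric]
  by (auto intro!: linearI simp: adjoint_add)

lemmas matrix_continuous_on [continuous_intros] =
  bounded_bilinear.continuous_on[OF bounded_bilinear_mult]
  bounded_linear.continuous_on[OF bounded_linear_cscale]
  bounded_linear.continuous_on[OF bounded_linear_adjoint]

lemmas matrix_has_vector_derivative =
  bounded_bilinear.has_vector_derivative[OF bounded_bilinear_mult]

section \<open>The compact group of unitary matrices\<close>

lemma unitary_groupD:
  assumes "U \<in> unitary_group"
  shows "U ** adjoint U = mat 1" "adjoint U ** U = mat 1"
  using assms by (auto simp: unitary_group_def)

lemma unitary_cancel:
  assumes "U \<in> unitary_group"
  shows "U ** (adjoint U ** A) = A" "adjoint U ** (U ** A) = A"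
    "(A ** U) ** adjoint U = A" "(A ** adjoint U) ** U = A"
  using unitary_groupD[OF assms] by (metis matrix_mul_assoc matrix_mul_lid matrix_mul_rid)+

lemma unitary_one [simp]: "mat 1 \<in> unitary_group"
  by (simp add: unitary_group_def)

lemma unitary_adjoint: "U \<in> unitary_group \<Longrightarrow> adjoint U \<in> unitary_group"
  by (simp add: unitary_group_def)

lemma unitary_mult:
  assumes "U \<in> unitary_group" "V \<in> unitary_group"
  shows "U ** V \<in> unitary_group"
  using unitary_cancel(1)[OF assms(2), of "adjoint U"] unitary_cancel(2)[OF assms(1), of V]
  by (simp add: unitary_group_def adjoint_mult matrix_mul_assoc[symmetric] unitary_groupD[OF assms(1)]
      unitary_groupD[OF assms(2)])

lemma norm_unitary_mult [simp]:
  assumes "U \<in> unitary_group"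
  shows "norm (U ** A) = norm A" "norm (A ** U) = norm A"
  using assms by (simp_all add: norm_eq_sqrt_inner inner_mult_left[of U] inner_mult_right[of _ U] unitary_cancel)

lemma closed_unitary_group: "closed (unitary_group :: 'n::finite cmat set)"
proof -
  have "unitary_group = {U::'n cmat. U ** adjoint U = mat 1} \<inter> {U. adjoint U ** U = mat 1}"
    by (auto simp: unitary_group_def)
  moreover have "closed \<dots>"
    by (intro closed_Int closed_Collect_eq continuous_intros)
  ultimately show ?thesis by simp
qed

lemma compact_unitary_group: "compact (unitary_group :: 'n::finite cmat set)"
proof -
  have "norm U = norm (mat 1 :: 'n cmat)" if "U \<in> unitary_group" for U :: "'n cmat"
    using norm_unitary_mult(1)[OF that, of "mat 1"] by simp
  then have "bounded (unitary_group :: 'n cmat set)"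
    by (metis boundedI order_refl)
  then show ?thesis
    using closed_unitary_group compact_eq_bounded_closed by blast
qed

section \<open>The matrix exponential and the evolution operators\<close>

lemma has_vector_derivative_vecI:
  fixes f :: "real \<Rightarrow> 'a::real_normed_vector ^ 'n::finite"
  assumes "\<And>i. ((\<lambda>t. f t $ i) has_vector_derivative f' $ i) (at t)"
  shows "(f has_vector_derivative f') (at t)"
  unfolding has_vector_derivative_def has_derivative_at_within
proof (intro conjI vec_tendstoI)
  show "bounded_linear (\<lambda>x. x *\<^sub>R f')"
    by (rule bounded_linear_scaleR_left)
  fix i
  show "((\<lambda>y. ((f y - f t - (y - t) *\<^sub>R f') /\<^sub>R norm (y - t)) $ i) \<longlongrightarrow> 0 $ i) (at t)"
    using assms[of i] by (simp add: has_vector_derivative_def has_derivative_at_within)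
qed

lemma mpow_commute: "mpow A k ** A = A ** mpow A k"
  by (induction k) (simp_all add: matrix_mul_assoc[symmetric])

lemma mpow_cscale: "mpow (cscale z A) k = cscale (z ^ k) (mpow A k)"
  by (induction k) (simp_all add: mult.commute)

lemma adjoint_mpow: "adjoint (mpow A k) = mpow (adjoint A) k"
  by (induction k) (simp_all add: adjoint_mult mpow_commute)

lemma summable_mexp: "summable (\<lambda>k. (1 / fact k) *\<^sub>R mpow (A :: 'n::finite cmat) k)"
proof -
  obtain K where K: "K > 0" "\<And>(A :: 'n cmat) (B :: 'n cmat). norm (A ** B) \<le> norm A * norm B * K"
    using bounded_bilinear.pos_bounded[OF bounded_bilinear_mult] by blast
  have bnd: "norm (mpow A k) \<le> norm (mat 1 :: 'n cmat) * (norm A * K) ^ k" for k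
  proof (induction k)
    case (Suc k)
    have "norm (mpow A (Suc k)) \<le> norm A * norm (mpow A k) * K"
      using K(2)[of A "mpow A k"] by simp
    also have "\<dots> \<le> norm A * (norm (mat 1 :: 'n cmat) * (norm A * K) ^ k) * K"
      using Suc K(1) by (intro mult_right_mono mult_left_mono) auto
    also have "\<dots> = norm (mat 1 :: 'n cmat) * (norm A * K) ^ Suc k"
      by (simp only: power_Suc mult_ac)
    finally show ?case .
  qed simp
  show ?thesis
  proof (rule summable_comparison_test'[where N = 0])
    show "summable (\<lambda>k. norm (mat 1 :: 'n cmat) * ((norm A * K) ^ k /\<^sub>R fact k))"
      by (intro summable_mult summable_exp_generic)
    fix k
    have "norm ((1 / fact k) *\<^sub>R mpow A k) = norm (mpow A k) / fact k"
      by simp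
    also have "\<dots> \<le> (norm (mat 1 :: 'n cmat) * (norm A * K) ^ k) / fact k"
      by (rule divide_right_mono[OF bnd]) simp
    also have "\<dots> = norm (mat 1 :: 'n cmat) * ((norm A * K) ^ k /\<^sub>R fact k)"
      by (simp only: real_scaleR_def divide_inverse mult_ac)
    finally show "norm ((1 / fact k) *\<^sub>R mpow A k) \<le> norm (mat 1 :: 'n cmat) * ((norm A * K) ^ k /\<^sub>R fact k)" .
  qed
qed

text \<open>Entrywise scalar power series in \<open>z\<close> make termwise complex differentiation
  available; \<open>evol\<close> is the case of imaginary \<open>z\<close>.\<close>

lemma sums_mexp_nth:
  "(\<lambda>k. mpow A k $ i $ j / fact k * z ^ k) sums (mexp (cscale z A) $ i $ j)"
proof -
  have "(\<lambda>k. (1 / fact k) *\<^sub>R mpow (cscale z A) k) sums mexp (cscale z A)"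
    unfolding mexp_def using summable_mexp by (rule summable_sums)
  then have "(\<lambda>k. ((1 / fact k) *\<^sub>R mpow (cscale z A) k) $ i $ j) sums (mexp (cscale z A) $ i $ j)"
    by (intro bounded_linear.sums[OF bounded_linear_vec_nth])
  then show ?thesis
    by (simp add: mpow_cscale scaleR_conv_of_real[where 'a = complex] mult.commute)
qed

lemma mexp_nth_DERIV:
  "((\<lambda>z. mexp (cscale z A) $ i $ j) has_field_derivative (A ** mexp (cscale z A)) $ i $ j) (at z)"
  "mexp (cscale z A) ** A = A ** mexp (cscale z A)"
proof -
  let ?c = "\<lambda>i j k. mpow A k $ i $ j / fact k"
  have eq: "(\<lambda>z. mexp (cscale z A) $ i $ j) = (\<lambda>z. \<Sum>k. ?c i j k * z ^ k)" for i j
    using sums_mexp_nth[of A i j] by (auto simp: sums_iff)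
  have summ: "summable (\<lambda>k. ?c i j k * z ^ k)" for i j z
    using sums_mexp_nth[of A i j z] by (rule sums_summable)
  have d: "((\<lambda>z. mexp (cscale z A) $ i $ j) has_field_derivative (\<Sum>k. diffs (?c i j) k * z ^ k)) (at z)" for i j
    unfolding eq by (rule termdiffs_strong_converges_everywhere) (rule summ)
  have dc: "diffs (?c i j) k = mpow A (Suc k) $ i $ j / fact k" for i j k
  proof -
    have "diffs (?c i j) k = of_nat (Suc k) * (mpow A (Suc k) $ i $ j / (of_nat (Suc k) * fact k))"
      unfolding diffs_def by (simp only: fact_Suc of_nat_mult of_nat_fact)
    then show ?thesis
      by (metis nonzero_mult_divide_mult_cancel_left of_nat_neq_0 times_divide_eq_right)
  qed
  have "(\<lambda>k. \<Sum>l\<in>UNIV. A $ i $ l * (?c l j k * z ^ k)) sums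
      (\<Sum>l\<in>UNIV. A $ i $ l * mexp (cscale z A) $ l $ j)" for i j
    by (intro sums_sum sums_mult sums_mexp_nth)
  then have s1: "(\<lambda>k. diffs (?c i j) k * z ^ k) sums (A ** mexp (cscale z A)) $ i $ j" for i j
    unfolding dc by (simp add: matrix_matrix_mult_def sum_distrib_left sum_distrib_right sum_divide_distrib mult_ac)
  \<comment> \<open>The product in either order has the same differentiated series, because powers
    of \<open>A\<close> commute with \<open>A\<close>; uniqueness of sums then gives the
    commutation.\<close>
  have "(\<lambda>k. \<Sum>l\<in>UNIV. (?c i l k * z ^ k) * A $ l $ j) sums
      (\<Sum>l\<in>UNIV. mexp (cscale z A) $ i $ l * A $ l $ j)" for i j
    by (intro sums_sum sums_mult2 sums_mexp_nth)
  then have s2: "(\<lambda>k. diffs (?c i j) k * z ^ k) sums (mexp (cscale z A) ** A) $ i $ j" for i j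
    unfolding dc mpow.simps mpow_commute[symmetric]
    by (simp add: matrix_matrix_mult_def sum_distrib_left sum_distrib_right sum_divide_distrib mult_ac)
  show "((\<lambda>z. mexp (cscale z A) $ i $ j) has_field_derivative (A ** mexp (cscale z A)) $ i $ j) (at z)"
    using d[of i j] s1[of i j] by (simp add: sums_iff)
  show "mexp (cscale z A) ** A = A ** mexp (cscale z A)"
    by (intro mat_eqI sums_unique2[OF s2 s1])
qed

lemma evol_has_vector_derivative:
  "(evol H has_vector_derivative cscale (- \<i>) (H ** evol H t)) (at t)"
proof (intro has_vector_derivative_vecI)
  fix i j
  have "((\<lambda>t. - \<i> * complex_of_real t) has_vector_derivative - \<i>) (at t)"
    by (auto intro!: derivative_eq_intros)
  from field_vector_diff_chain_at[OF this mexp_nth_DERIV(1)[of H i j]]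
  show "((\<lambda>t. evol H t $ i $ j) has_vector_derivative cscale (- \<i>) (H ** evol H t) $ i $ j) (at t)"
    by (simp add: evol_def o_def)
qed

lemma evol_commute: "evol H t ** H = H ** evol H t"
  unfolding evol_def by (rule mexp_nth_DERIV(2))

lemma evol_zero [simp]: "evol H 0 = mat 1"
proof -
  have "mexp (cscale 0 H) $ i $ j = mpow H 0 $ i $ j" for i j
    using sums_unique2[OF sums_mexp_nth[of H i j 0] powser_sums_zero] by simp
  then show ?thesis by (intro mat_eqI) (simp add: evol_def)
qed

lemma constant_if_vector_derivative_zero:
  fixes f :: "real \<Rightarrow> 'a::real_normed_vector"
  assumes "\<And>t. (f has_vector_derivative 0) (at t)"
  shows "f s = f t"
  using has_derivative_zero_unique_connected[of UNIV f s t] assms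
  by (auto simp: has_vector_derivative_def)

text \<open>The product has zero derivative in \<open>s\<close>, since \<open>H\<close> commutes
  with its evolution. Inverses and the group law follow without multiplying exponential
  series.\<close>

lemma evol_cancel_add: "evol H (- s) ** evol H (t + s) = evol H t"
proof -
  have "((\<lambda>s. evol H (- s) ** evol H (t + s)) has_vector_derivative 0) (at s)" for s
  proof -
    have m: "((\<lambda>s. - s) has_vector_derivative -1) (at s)"
      and p: "((\<lambda>s. t + s) has_vector_derivative 1) (at s)"
      by (auto intro!: derivative_eq_intros)
    have 1: "((\<lambda>s. evol H (- s)) has_vector_derivative cscale \<i> (H ** evol H (- s))) (at s)"
      using vector_diff_chain_at[OF m evol_has_vector_derivative[of H "- s"]] by (simp add: o_def)
    have 2: "((\<lambda>s. evol H (t + s)) has_vector_derivative cscale (-\<i>) (H ** evol H (t + s))) (at s)"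
      using vector_diff_chain_at[OF p evol_has_vector_derivative[of H "t + s"]] by (simp add: o_def)
    show ?thesis
      using matrix_has_vector_derivative[OF 1 2]
      by (simp add: matrix_mul_assoc evol_commute)
  qed
  from constant_if_vector_derivative_zero[OF this, of s 0] show ?thesis by simp
qed

lemma evol_minus_cancel: "evol H (- s) ** evol H s = mat 1" "evol H s ** evol H (- s) = mat 1"
  using evol_cancel_add[of H s 0] evol_cancel_add[of H "-s" 0] by simp_all

lemma evol_add: "evol H (s + t) = evol H s ** evol H t"
proof -
  have "evol H s ** (evol H (- s) ** evol H (t + s)) = evol H (t + s)"
    by (simp add: matrix_mul_assoc evol_minus_cancel)
  then show ?thesis unfolding evol_cancel_add by (simp add: add.commute[of s])
qed

lemma adjoint_evol:
  assumes "hermitian H"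
  shows "adjoint (evol H t) = evol H (- t)"
proof -
  have "adjoint (mexp A) = mexp (adjoint A)" for A :: "'n::finite cmat"
    unfolding mexp_def using bounded_linear.suminf[OF bounded_linear_adjoint summable_mexp[of A], symmetric]
    by (simp add: adjoint_mpow)
  from this[of "cscale (- \<i> * complex_of_real t) H"] show ?thesis
    using assms by (simp add: evol_def hermitian_def)
qed

lemma evol_unitary: "hermitian H \<Longrightarrow> evol H t \<in> unitary_group"
  by (simp add: unitary_group_def adjoint_evol evol_minus_cancel)

lemma continuous_on_evol [continuous_intros]:
  assumes "continuous_on S f"
  shows "continuous_on S (\<lambda>x. evol H (f x))"
proof -
  have "continuous_on UNIV (evol H)"
    by (simp add: continuous_on_eq_continuous_at
        has_vector_derivative_continuous[OF evol_has_vector_derivative])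
  from continuous_on_compose2[OF this assms] show ?thesis by simp
qed

section \<open>The rank condition\<close>

definition comm :: "'n::finite cmat \<Rightarrow> 'n cmat \<Rightarrow> 'n cmat" where
  "comm A B = A ** B - B ** A"

text \<open>Built on the real \<open>subspace\<close>, so that closedness and orthogonal
  decomposition in the real inner product apply.\<close>

definition csubspace :: "'n::finite cmat set \<Rightarrow> bool" where
  "csubspace V \<longleftrightarrow> subspace V \<and> (\<forall>c. \<forall>X\<in>V. cscale c X \<in> V)"

lemma csubspaceD:
  assumes "csubspace V"
  shows "subspace V" "0 \<in> V" "X \<in> V \<Longrightarrow> cscale c X \<in> V"
    "X \<in> V \<Longrightarrow> Y \<in> V \<Longrightarrow> X + Y \<in> V" "X \<in> V \<Longrightarrow> Y \<in> V \<Longrightarrow> X - Y \<in> V"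
    "X \<in> V \<Longrightarrow> - X \<in> V" "(\<And>i. i \<in> I \<Longrightarrow> f i \<in> V) \<Longrightarrow> sum f I \<in> V"
  using assms by (auto simp: csubspace_def subspace_0 subspace_add subspace_diff subspace_neg
      intro!: subspace_sum)

lemma csubspaceI:
  assumes "0 \<in> V" "\<And>X Y. X \<in> V \<Longrightarrow> Y \<in> V \<Longrightarrow> X + Y \<in> V" "\<And>c X. X \<in> V \<Longrightarrow> cscale c X \<in> V"
  shows "csubspace V"
  using assms by (auto simp: csubspace_def subspace_def scaleR_eq_cscale)

lemma csubspace_hull: "csubspace (csubspace hull G)"
  by (rule hull_in) (auto simp: Ball_def intro!: csubspaceI dest: csubspaceD)

lemma comm_add: "comm A (X + Y) = comm A X + comm A Y"
  and comm_add_left: "comm (A + B) X = comm A X + comm B X"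
  and comm_cscale: "comm A (cscale c X) = cscale c (comm A X)"
  and comm_cscale_left: "comm (cscale c A) X = cscale c (comm A X)"
  and comm_zero [simp]: "comm A 0 = 0"
  by (simp_all add: comm_def matrix_add_ldistrib matrix_add_rdistrib cscale_diff)

lemma csubspace_linear_vimage:
  assumes "csubspace V" "f 0 = 0" "\<And>X Y. f (X + Y) = f X + f Y" "\<And>c X. f (cscale c X) = cscale c (f X)"
  shows "csubspace {X. f X \<in> V}"
  by (intro csubspaceI) (simp_all add: assms csubspaceD[OF assms(1)])

lemma csubspace_hull_invariant:
  assumes "f 0 = 0" "\<And>X Y. f (X + Y) = f X + f Y" "\<And>c X. f (cscale c X) = cscale c (f X)"
    and "\<And>X. X \<in> G \<Longrightarrow> f X \<in> csubspace hull G" and "X \<in> csubspace hull G"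
  shows "f X \<in> csubspace hull G"
proof -
  have "csubspace hull G \<subseteq> {X. f X \<in> csubspace hull G}"
    using assms(4) by (intro hull_minimal csubspace_linear_vimage csubspace_hull assms(1-3)) blast
  then show ?thesis using assms(5) by blast
qed

text \<open>By the Jacobi identity, nested commutators with a single generator on the left already
  span the Lie algebra generated by \<open>H1\<close> and \<open>H2\<close>, so Boolean words index
  a spanning family.\<close>

primrec bracket :: "'n::finite cmat \<Rightarrow> 'n cmat \<Rightarrow> bool \<Rightarrow> bool list \<Rightarrow> 'n cmat" where
  "bracket H1 H2 k [] = (if k then H1 else H2)"
| "bracket H1 H2 k (j # w) = comm (if j then H1 else H2) (bracket H1 H2 k w)"

definition flat :: "'n::finite cmat \<Rightarrow> complex ^ ('n \<times> 'n)" where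
  "flat A = (\<chi> p. A $ fst p $ snd p)"

text \<open>Flattening matrices to vectors expresses that some family of iterated commutators is a basis of
  the complex matrices by a single determinant.\<close>
definition rank_cond :: "'n::finite cmat \<Rightarrow> 'n cmat \<Rightarrow> bool" where
  "rank_cond H1 H2 \<longleftrightarrow> (\<exists>k w. det (\<chi> p::'n \<times> 'n. flat (bracket H1 H2 (k p) (w p))) \<noteq> 0)"

lemma flat_nth [simp]: "flat A $ p = A $ fst p $ snd p"
  by (simp add: flat_def)

lemma flat_add: "flat (A + B) = flat A + flat B"
  and flat_cscale: "flat (cscale c A) = c *s flat A"
  and flat_zero [simp]: "flat 0 = 0"
  by (simp_all add: vec_eq_iff)

text \<open>Such a \<open>V\<close> contains every nested commutator, and the invertible matrix
  whose rows are flattened commutators expresses any matrix through them.\<close>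

lemma rank_cond_UNIV:
  assumes "rank_cond H1 H2" "csubspace V" "H1 \<in> V" "H2 \<in> V"
    and "\<And>X. X \<in> V \<Longrightarrow> comm H1 X \<in> V" "\<And>X. X \<in> V \<Longrightarrow> comm H2 X \<in> V"
  shows "V = UNIV"
proof -
  obtain k w where kw: "det (\<chi> p. flat (bracket H1 H2 (k p) (w p))) \<noteq> 0"
    using assms(1) by (auto simp: rank_cond_def)
  define B where "B p = bracket H1 H2 (k p) (w p)" for p
  have BV: "B p \<in> V" for p
  proof -
    have "bracket H1 H2 k w \<in> V" for k w
      by (induction w) (use assms in auto)
    then show ?thesis by (simp add: B_def)
  qed
  define M where "M = (\<chi> p. flat (B p))"
  have "invertible M"
    using kw by (simp add: invertible_det_nz M_def B_def)
  then obtain N where N: "N ** M = mat 1"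
    by (auto simp: invertible_def)
  have "X \<in> V" for X
  proof -
    \<comment> \<open>The coordinates of \<open>X\<close> in the basis \<open>B\<close> are the row
      vector \<open>flat X\<close> times the inverse \<open>N\<close>.\<close>
    define c where "c p = (\<Sum>q\<in>UNIV. flat X $ q * N $ q $ p)" for p
    have "flat X $ q = (\<Sum>p\<in>UNIV. c p * M $ p $ q)" for q
    proof -
      have "(\<Sum>p\<in>UNIV. c p * M $ p $ q) = (\<Sum>p\<in>UNIV. \<Sum>r\<in>UNIV. flat X $ r * (N $ r $ p * M $ p $ q))"
        by (simp only: c_def sum_distrib_right mult.assoc)
      also have "\<dots> = (\<Sum>r\<in>UNIV. \<Sum>p\<in>UNIV. flat X $ r * (N $ r $ p * M $ p $ q))"
        by (rule sum.swap)
      also have "\<dots> = (\<Sum>r\<in>UNIV. flat X $ r * (N ** M) $ r $ q)"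
        by (simp add: matrix_matrix_mult_def sum_distrib_left del: flat_nth)
      also have "\<dots> = (\<Sum>r\<in>UNIV. if r = q then flat X $ r else 0)"
        unfolding N by (intro sum.cong) (auto simp: mat_def)
      finally show ?thesis by simp
    qed
    from this[of "(i, j)" for i j] have "X = (\<Sum>p\<in>UNIV. cscale (c p) (B p))"
      by (intro mat_eqI) (simp add: M_def sum_component)
    also have "\<dots> \<in> V"
      by (intro csubspaceD(7)[OF assms(2)] csubspaceD(3)[OF assms(2)] BV)
    finally show ?thesis .
  qed
  then show ?thesis by blast
qed

lemma rank_condI:
  fixes H1 H2 :: "'n::finite cmat"
  assumes "\<And>V. \<lbrakk>csubspace V; H1 \<in> V; H2 \<in> V; \<And>X. X \<in> V \<Longrightarrow> comm H1 X \<in> V;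
      \<And>X. X \<in> V \<Longrightarrow> comm H2 X \<in> V\<rbrakk> \<Longrightarrow> V = UNIV"
  shows "rank_cond H1 H2"
proof -
  define S where "S = {flat (bracket H1 H2 k w) | k w. True}"
  define G where "G = {bracket H1 H2 k w | k w. True}"
  have "csubspace hull G = UNIV"
  proof (rule assms)
    show "csubspace (csubspace hull G)" by (rule csubspace_hull)
    have "bracket H1 H2 True [] \<in> G" "bracket H1 H2 False [] \<in> G"
      unfolding G_def by blast+
    then show "H1 \<in> csubspace hull G" "H2 \<in> csubspace hull G"
      by (auto intro: hull_inc)
    have *: "comm (if j then H1 else H2) X \<in> csubspace hull G" if "X \<in> csubspace hull G" for j X
    proof (rule csubspace_hull_invariant[OF _ _ _ _ that])
      fix X assume "X \<in> G"
      then obtain k w where "X = bracket H1 H2 k w" by (auto simp: G_def)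
      then have "comm (if j then H1 else H2) X = bracket H1 H2 k (j # w)" by simp
      then have "comm (if j then H1 else H2) X \<in> G" unfolding G_def by blast
      then show "comm (if j then H1 else H2) X \<in> csubspace hull G" by (rule hull_inc)
    qed (simp_all add: comm_add comm_cscale)
    show "comm H1 X \<in> csubspace hull G" "comm H2 X \<in> csubspace hull G" if "X \<in> csubspace hull G" for X
      using *[OF that, of True] *[OF that, of False] by simp_all
  qed
  moreover have "csubspace hull G \<subseteq> {X. flat X \<in> vec.span S}"
  proof (rule hull_minimal)
    show "G \<subseteq> {X. flat X \<in> vec.span S}"
      by (auto simp: G_def S_def intro!: vec.span_base)
    show "csubspace {X. flat X \<in> vec.span S}"
      by (intro csubspaceI) (simp_all add: flat_add flat_cscale vec.span_add vec.span_scale vec.span_zero)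
  qed
  ultimately have flat_span: "flat X \<in> vec.span S" for X by blast
  have span: "vec.span S = UNIV"
  proof -
    have "x \<in> vec.span S" for x :: "complex ^ ('n \<times> 'n)"
    proof -
      have "flat (\<chi> i j. x $ (i, j)) = x" by (simp add: vec_eq_iff)
      then show ?thesis using flat_span by metis
    qed
    then show ?thesis by blast
  qed
  obtain B where B: "B \<subseteq> S" "vec.independent B" "S \<subseteq> vec.span B" "card B = vec.dim S"
    using vec.basis_exists by blast
  have "vec.dim S = CARD('n \<times> 'n)"
    using vec.dim_span[of S] by (simp only: span vec_dim_card)
  moreover have "finite B"
    using B(2) vec.finiteI_independent by blast
  ultimately obtain h where h: "bij_betw h (UNIV :: ('n \<times> 'n) set) B"
    using B(4) finite_same_card_bij[of "UNIV :: ('n \<times> 'n) set" B] by auto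
  have "\<exists>k w. h p = flat (bracket H1 H2 k w)" for p
  proof -
    have "h p \<in> S" using bij_betwE[OF h] B(1) by blast
    then show ?thesis by (simp add: S_def)
  qed
  then obtain k w where kw: "\<And>p. h p = flat (bracket H1 H2 (k p) (w p))"
    by metis
  define M :: "complex ^ ('n \<times> 'n) ^ ('n \<times> 'n)" where "M = (\<chi> p. flat (bracket H1 H2 (k p) (w p)))"
  have "rows M = B"
  proof -
    have "row p M = h p" for p
      by (simp add: row_def M_def kw vec_eq_iff)
    then have "rows M = range h"
      by (auto simp: rows_def)
    then show ?thesis
      using h by (simp add: bij_betw_def)
  qed
  moreover have "vec.span B = UNIV"
    using vec.span_minimal[OF B(3) vec.subspace_span] span by blast
  ultimately have "\<exists>N. N ** M = mat 1"
    using matrix_left_invertible_span_rows_gen by metis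
  then have "invertible M"
    using invertible_left_inverse by blast
  then have "det M \<noteq> 0" by (simp add: invertible_det_nz)
  then show ?thesis
    unfolding rank_cond_def M_def by blast
qed

section \<open>Matrix units and ideals of gl(N)\<close>

definition munit :: "'n::finite \<Rightarrow> 'n \<Rightarrow> 'n cmat" where
  "munit i j = (\<chi> k l. if k = i \<and> l = j then 1 else 0)"

lemma munit_nth [simp]: "munit i j $ k $ l = (if k = i \<and> l = j then 1 else 0)"
  by (simp add: munit_def)

lemma mult_munit_nth [simp]: "(A ** munit i j) $ k $ l = (if l = j then A $ k $ i else 0)"
  and munit_mult_nth [simp]: "(munit i j ** A) $ k $ l = (if k = i then A $ j $ l else 0)"
proof -
  have "(A ** munit i j) $ k $ l = (\<Sum>m\<in>UNIV. if m = i then (if l = j then A $ k $ i else 0) else 0)"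
    unfolding matrix_matrix_mult_def vec_lambda_beta by (intro sum.cong) auto
  then show "(A ** munit i j) $ k $ l = (if l = j then A $ k $ i else 0)" by simp
  have "(munit i j ** A) $ k $ l = (\<Sum>m\<in>UNIV. if m = j then (if k = i then A $ j $ l else 0) else 0)"
    unfolding matrix_matrix_mult_def vec_lambda_beta by (intro sum.cong) auto
  then show "(munit i j ** A) $ k $ l = (if k = i then A $ j $ l else 0)" by simp
qed

lemma comm_munit_nth: "comm (munit i j) A $ k $ l =
    (if k = i then A $ j $ l else 0) - (if l = j then A $ k $ i else 0)"
  by (simp add: comm_def)

lemma munit_expansion: "X = (\<Sum>i\<in>UNIV. \<Sum>j\<in>UNIV. cscale (X $ i $ j) (munit i j))"
proof (rule mat_eqI)
  fix k l
  have "(\<Sum>i\<in>UNIV. \<Sum>j\<in>UNIV. X $ i $ j * munit i j $ k $ l) =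
      (\<Sum>i\<in>UNIV. if i = k then (\<Sum>j\<in>UNIV. if j = l then X $ k $ l else 0) else 0)"
  proof (intro sum.cong refl)
    fix i
    have "(\<Sum>j\<in>UNIV. X $ i $ j * munit i j $ k $ l) = (\<Sum>j\<in>UNIV. if j = l then (if i = k then X $ k $ l else 0) else 0)"
      by (intro sum.cong) auto
    then show "(\<Sum>j\<in>UNIV. X $ i $ j * munit i j $ k $ l) = (if i = k then \<Sum>j\<in>UNIV. if j = l then X $ k $ l else 0 else 0)"
      by simp
  qed
  then show "X $ k $ l = (\<Sum>i\<in>UNIV. \<Sum>j\<in>UNIV. cscale (X $ i $ j) (munit i j)) $ k $ l"
    by (simp add: sum_component)
qed

text \<open>Off-diagonal units and differences of diagonal units span the traceless matrices, a
  hyperplane; one member of nonzero trace completes it.\<close>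

lemma csubspace_eq_UNIV:
  assumes V: "csubspace V" and off: "\<And>i j. i \<noteq> j \<Longrightarrow> munit i j \<in> V"
    and diag: "\<And>i j. munit i i - munit j j \<in> V" and X: "X \<in> V" "trace X \<noteq> 0"
  shows "V = UNIV"
proof -
  note V' = csubspaceD[OF V]
  obtain a :: 'a where True by simp
  \<comment> \<open>\<open>F i j\<close> is the unit corrected to trace zero at the index
    \<open>a\<close>, so expanding \<open>Y\<close> in it leaves exactly \<open>trace Y\<close>
    times \<open>munit a a\<close>.\<close>
  define F where "F i j = munit i j - (if i = j then munit a a else 0)" for i j
  have F: "F i j \<in> V" for i j
    using off diag[of i a] by (auto simp: F_def)
  have expand: "Y = (\<Sum>i\<in>UNIV. \<Sum>j\<in>UNIV. cscale (Y $ i $ j) (F i j)) + cscale (trace Y) (munit a a)" for Y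
  proof -
    have "(\<Sum>i\<in>UNIV. \<Sum>j\<in>UNIV. cscale (Y $ i $ j) (F i j)) + cscale (trace Y) (munit a a) =
        (\<Sum>i\<in>UNIV. (\<Sum>j\<in>UNIV. cscale (Y $ i $ j) (F i j)) + cscale (Y $ i $ i) (munit a a))"
      unfolding trace_def sum.distrib
      by (intro arg_cong2[of _ _ _ _ "(+)"] refl mat_eqI) (simp add: sum_component sum_distrib_right)
    also have "\<dots> = (\<Sum>i\<in>UNIV. \<Sum>j\<in>UNIV. cscale (Y $ i $ j) (F i j) +
        (if j = i then cscale (Y $ i $ i) (munit a a) else 0))"
      unfolding sum.distrib by simp
    also have "\<dots> = (\<Sum>i\<in>UNIV. \<Sum>j\<in>UNIV. cscale (Y $ i $ j) (munit i j))"
      by (intro sum.cong refl) (auto simp: F_def cscale_diff)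
    finally show ?thesis using munit_expansion[of Y] by simp
  qed
  have "cscale (trace X) (munit a a) = X - (\<Sum>i\<in>UNIV. \<Sum>j\<in>UNIV. cscale (X $ i $ j) (F i j))"
    using expand[of X] by (simp add: algebra_simps)
  also have "\<dots> \<in> V" by (intro V' X F)
  finally have "cscale (1 / trace X) (cscale (trace X) (munit a a)) \<in> V" by (rule V'(3))
  then have "munit a a \<in> V" using X(2) by simp
  then have "Y \<in> V" for Y
    by (subst expand) (intro V' F)
  then show ?thesis by blast
qed

text \<open>The second condition on \<open>X\<close> says that it is not scalar. Double commutators
  extract one off-diagonal unit from it, and further commutators move that unit to any off-diagonal
  position.\<close>

lemma ideal_munit:
  assumes V: "csubspace V" and ideal: "\<And>K X. X \<in> V \<Longrightarrow> comm K X \<in> V"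
    and X: "X \<in> V" "X \<noteq> cscale (X $ a $ a) (mat 1)" and kl: "k \<noteq> l"
  shows "munit k l \<in> V"
proof -
  note V' = csubspaceD[OF V]
  \<comment> \<open>Commuting twice with \<open>munit j i\<close> annihilates all of
    \<open>Y\<close> except its entry \<open>(i, j)\<close>, which returns as the coefficient of
    \<open>munit j i\<close>.\<close>
  have off: "munit j i \<in> V" if Y: "Y \<in> V" "Y $ i $ j \<noteq> 0" "i \<noteq> j" for Y i j
  proof -
    have "comm (munit j i) (comm (munit j i) Y) = cscale (- 2 * Y $ i $ j) (munit j i)"
      using Y(3) by (intro mat_eqI) (simp add: comm_munit_nth)
    moreover have "comm (munit j i) (comm (munit j i) Y) \<in> V"
      by (intro ideal Y)
    ultimately have "cscale (- 2 * Y $ i $ j) (munit j i) \<in> V"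
      by simp
    then have "cscale (1 / (- 2 * Y $ i $ j)) (cscale (- 2 * Y $ i $ j) (munit j i)) \<in> V"
      by (rule V'(3))
    then show ?thesis using Y(2) by simp
  qed
  have "\<exists>i j. i \<noteq> j \<and> munit j i \<in> V"
  proof (cases "\<exists>i j. i \<noteq> j \<and> X $ i $ j \<noteq> 0")
    case True
    then obtain i j where "i \<noteq> j" "X $ i $ j \<noteq> 0" by blast
    then have "i \<noteq> j \<and> munit j i \<in> V" using off[OF X(1)] by simp
    then show ?thesis by blast
  next
    case False
    \<comment> \<open>A diagonal nonscalar matrix has two different diagonal entries; commuting with
      \<open>munit a b\<close> turns their difference into an off-diagonal entry.\<close>
    have "\<exists>b. X $ b $ b \<noteq> X $ a $ a"
    proof (rule ccontr)
      assume "\<not> ?thesis"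
      then have "X = cscale (X $ a $ a) (mat 1)"
        using False by (intro mat_eqI) (auto simp: mat_def)
      then show False using X(2) by contradiction
    qed
    then obtain b where b: "X $ b $ b \<noteq> X $ a $ a" by blast
    then have "a \<noteq> b" by auto
    moreover have "comm (munit a b) X $ a $ b \<noteq> 0"
      using b by (simp add: comm_munit_nth)
    ultimately have "munit b a \<in> V"
      using off[OF ideal[OF X(1), of "munit a b"], of a b] by simp
    then show ?thesis using \<open>a \<noteq> b\<close> by blast
  qed
  then obtain i j where ij: "i \<noteq> j" "munit j i \<in> V" by blast
  have row: "munit k i' \<in> V" if "munit j i' \<in> V" "j \<noteq> i'" "k \<noteq> i'" for j k i'
  proof -
    have "comm (munit k j) (munit j i') = munit k i'"
      using that by (intro mat_eqI) (simp add: comm_munit_nth)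
    then show ?thesis using ideal[OF that(1), of "munit k j"] by simp
  qed
  have col: "munit j l \<in> V" if "munit j i \<in> V" "j \<noteq> i" "j \<noteq> l" for i j l
  proof -
    have "comm (munit i l) (munit j i) = - munit j l"
      using that by (intro mat_eqI) (simp add: comm_munit_nth)
    then show ?thesis using V'(6)[OF ideal[OF that(1), of "munit i l"]] by simp
  qed
  show ?thesis
  proof (cases "l = j")
    case False
    then have "munit j l \<in> V" using col[OF ij(2), of l] ij(1) by simp
    then show ?thesis using row[of j l k] False kl by simp
  next
    \<comment> \<open>A column move within row \<open>j\<close> would end on the diagonal; the
      transposed unit already lies in column \<open>l\<close>, and a row move suffices.\<close>
    case True
    have "munit i j \<in> V" using off[OF ij(2)] ij(1) by simp
    then show ?thesis using row[of i j k] ij(1) kl True by simp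
  qed
qed


section \<open>An explicit pair satisfying the rank condition\<close>

lemma power3_diff_eq_imp:
  fixes a b c d :: nat
  assumes eq: "(3::nat) ^ a + 3 ^ d = 3 ^ c + 3 ^ b" and "a \<noteq> b"
  shows "a = c \<and> b = d"
proof -
  \<comment> \<open>A power of 3 exceeds the sum of any two smaller ones, so the largest exponent
    occurs on both sides of \<open>eq\<close>, which encodes an equality of differences without
    subtraction.\<close>
  have less: "(3::nat) ^ x + 3 ^ y < 3 ^ z" if "x < z" "y < z" for x y z :: nat
  proof -
    obtain m where z: "z = Suc m" using \<open>x < z\<close> by (cases z) auto
    have "(3::nat) ^ x \<le> 3 ^ m" "(3::nat) ^ y \<le> 3 ^ m"
      using that z by (auto intro!: power_increasing)
    moreover have "(0::nat) < 3 ^ m" by simp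
    ultimately show ?thesis unfolding z power_Suc by linarith
  qed
  have "a \<le> c \<or> a \<le> b" "d \<le> c \<or> d \<le> b" "c \<le> a \<or> c \<le> d" "b \<le> a \<or> b \<le> d"
    using less[of c a b] less[of c d b] less[of a c d] less[of a b d] eq by linarith+
  moreover have "c \<noteq> d"
    using eq \<open>a \<noteq> b\<close> by auto
  ultimately have "a = c \<or> b = d" using \<open>a \<noteq> b\<close> by linarith
  then show ?thesis
  proof
    assume 1: "a = c"
    then have "(3::nat) ^ d = 3 ^ b" using eq by simp
    then show ?thesis using 1 by simp
  next
    assume 2: "b = d"
    then have "(3::nat) ^ a = 3 ^ c" using eq by simp
    then show ?thesis using 2 by simp
  qed
qed

text \<open>\<open>D\<close> is diagonal, and the differences of its distinct entries determine the
  index pair. Polynomials in the operator \<open>comm D\<close> therefore isolate each off-diagonal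
  entry of the all-ones matrix \<open>J\<close>.\<close>

lemma ex_rank_cond: "\<exists>D J :: 'n::finite cmat. hermitian D \<and> hermitian J \<and> rank_cond D J"
proof -
  obtain f :: "'n \<Rightarrow> nat" where f: "inj f"
    using finite_imp_inj_to_nat_seg[of "UNIV :: 'n set"] by auto
  define d :: "'n \<Rightarrow> complex" where "d i = of_nat (3 ^ f i)" for i
  define D :: "'n cmat" where "D = (\<chi> i j. if i = j then d i else 0)"
  define J :: "'n cmat" where "J = (\<chi> i j. 1)"
  have J_nth: "J $ i $ j = 1" for i j by (simp add: J_def)
  have d_eq: "k = i \<and> l = j" if "d k - d l = d i - d j" "i \<noteq> j" for i j k l
  proof -
    have "d i + d l = d k + d j" using that(1) by (simp add: algebra_simps)
    then have "of_nat (3 ^ f i + 3 ^ f l) = (of_nat (3 ^ f k + 3 ^ f j) :: complex)"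
      by (simp add: d_def)
    then have "(3::nat) ^ f i + 3 ^ f l = 3 ^ f k + 3 ^ f j"
      by (simp only: of_nat_eq_iff)
    then show ?thesis
      using power3_diff_eq_imp[of "f i" "f l" "f k" "f j"] that(2) injD[OF f] by blast
  qed
  have "D ** X = (\<chi> i j. d i * X $ i $ j)" "X ** D = (\<chi> i j. X $ i $ j * d j)" for X
    by (simp_all add: vec_eq_iff matrix_matrix_mult_def D_def if_distrib[of "\<lambda>x. x * _"]
        if_distrib[of "\<lambda>x. _ * x"] cong: if_cong)
  then have comm_D: "comm D X $ i $ j = (d i - d j) * X $ i $ j" for X i j
    by (simp add: comm_def algebra_simps)
  have "rank_cond D J"
  proof (rule rank_condI)
    fix V assume V: "csubspace V" and DJ: "D \<in> V" "J \<in> V"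
      and inv: "\<And>X. X \<in> V \<Longrightarrow> comm D X \<in> V" "\<And>X. X \<in> V \<Longrightarrow> comm J X \<in> V"
    note V' = csubspaceD[OF V]
    \<comment> \<open>\<open>comm D\<close> multiplies the entry \<open>(i, j)\<close> by
      \<open>d i - d j\<close>, so this matrix arises from \<open>J\<close> by applying
      \<open>comm D\<close> minus \<open>c\<close> for every \<open>c\<close> in
      \<open>F\<close>.\<close>
    have filter: "(\<chi> i j. \<Prod>c\<in>F. (d i - d j - c)) \<in> V" if "finite F" for F
      using that
    proof induction
      case empty
      then show ?case using DJ(2) by (simp add: J_def)
    next
      case (insert c F)
      let ?M = "\<chi> i j. \<Prod>c\<in>F. (d i - d j - c)"
      have "comm D ?M - cscale c ?M \<in> V"
        by (intro V' inv insert.IH)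
      also have "comm D ?M - cscale c ?M = (\<chi> i j. \<Prod>c\<in>insert c F. (d i - d j - c))"
        using insert.hyps by (intro mat_eqI) (simp add: comm_D algebra_simps)
      finally show ?case .
    qed
    have off: "munit i j \<in> V" if "i \<noteq> j" for i j
    proof -
      \<comment> \<open>All other differences, including the value 0 of the diagonal: the filter
        kills every entry except \<open>(i, j)\<close>, where \<open>q\<close> remains.\<close>
      define F where "F = (\<lambda>(k, l). d k - d l) ` UNIV - {d i - d j}"
      define q where "q = (\<Prod>c\<in>F. (d i - d j - c))"
      have "finite F" by (simp add: F_def)
      have "q \<noteq> 0" using \<open>finite F\<close> by (auto simp: q_def F_def)
      have "(\<Prod>c\<in>F. (d k - d l - c)) = 0" if "\<not> (k = i \<and> l = j)" for k l
      proof (rule prod_zero[OF \<open>finite F\<close>])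
        have "d k - d l \<in> F"
          using that d_eq[OF _ \<open>i \<noteq> j\<close>, of k l] by (auto simp: F_def image_def)
        then show "\<exists>c\<in>F. d k - d l - c = 0" by force
      qed
      then have "(\<chi> i j. \<Prod>c\<in>F. (d i - d j - c)) = cscale q (munit i j)"
        by (intro mat_eqI) (auto simp: q_def)
      then have "cscale (1 / q) (cscale q (munit i j)) \<in> V"
        using V'(3)[OF filter[OF \<open>finite F\<close>], of "1 / q"] by (simp only:)
      then show ?thesis using \<open>q \<noteq> 0\<close> by simp
    qed
    have diag: "munit i i - munit j j \<in> V" for i j
    proof (cases "i = j")
      case False
      have col: "(\<Sum>k\<in>UNIV - {i}. munit k i) $ k $ l = (if l = i \<and> k \<noteq> i then 1 else 0)" for k l
      proof -
        have "(\<Sum>k\<in>UNIV - {i}. munit k i) $ k $ l =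
            (\<Sum>m\<in>UNIV - {i}. if m = k then (if l = i then 1 else 0) else 0)"
          unfolding sum_component by (intro sum.cong) auto
        then show ?thesis by (simp add: sum.delta)
      qed
      have row: "(\<Sum>l\<in>UNIV - {j}. munit j l) $ k $ l = (if k = j \<and> l \<noteq> j then 1 else 0)" for k l
      proof -
        have "(\<Sum>l\<in>UNIV - {j}. munit j l) $ k $ l =
            (\<Sum>m\<in>UNIV - {j}. if m = l then (if k = j then 1 else 0) else 0)"
          unfolding sum_component by (intro sum.cong) auto
        then show ?thesis by (simp add: sum.delta)
      qed
      \<comment> \<open>The commutator is a column \<open>i\<close> of ones minus a row
        \<open>j\<close> of ones; removing the off-diagonal units leaves the diagonal
        difference.\<close>
      have "comm J (munit j i) - (\<Sum>k\<in>UNIV - {i}. munit k i) + (\<Sum>l\<in>UNIV - {j}. munit j l) \<in> V"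
        using False by (intro V' inv off) auto
      also have "comm J (munit j i) - (\<Sum>k\<in>UNIV - {i}. munit k i) + (\<Sum>l\<in>UNIV - {j}. munit j l) =
          munit i i - munit j j"
        using False by (intro mat_eqI) (simp add: comm_def J_nth col row)
      finally show ?thesis .
    qed (simp add: V')
    have "trace D = of_nat (\<Sum>i\<in>UNIV. 3 ^ f i)"
      by (simp add: trace_def D_def d_def)
    moreover have "(\<Sum>i\<in>UNIV. (3::nat) ^ f i) \<noteq> 0"
      by (simp add: sum_eq_0_iff)
    ultimately have "trace D \<noteq> 0" by (metis of_nat_eq_0_iff)
    then show "V = UNIV"
      using csubspace_eq_UNIV[OF V off diag DJ(1)] by simp
  qed
  moreover have "hermitian D" "hermitian J"
    by (auto simp: hermitian_def vec_eq_iff D_def J_def d_def)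
  ultimately show ?thesis by blast
qed

section \<open>Necessity of the rank condition\<close>

lemma vector_derivative_in_subspace:
  fixes g :: "real \<Rightarrow> 'a::euclidean_space"
  assumes V: "subspace V" and g: "(g has_vector_derivative D) (at 0)" and mem: "\<And>t. t \<ge> 0 \<Longrightarrow> g t \<in> V"
  shows "D \<in> V"
proof (rule Lim_in_closed_set)
  show "closed V" using V by (rule closed_subspace)
  have "((\<lambda>y. (g y - g 0 - y *\<^sub>R D) /\<^sub>R \<bar>y\<bar>) \<longlongrightarrow> 0) (at 0)"
    using g by (simp add: has_vector_derivative_def has_derivative_at_within)
  then have "((\<lambda>y. (g y - g 0 - y *\<^sub>R D) /\<^sub>R \<bar>y\<bar>) \<longlongrightarrow> 0) (at_right 0)"
    by (rule tendsto_mono[OF at_le[OF subset_UNIV]])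
  then have "((\<lambda>y. (g y - g 0) /\<^sub>R y - D) \<longlongrightarrow> 0) (at_right 0)"
    by (rule Lim_transform_eventually)
      (auto simp: eventually_at_right_less scaleR_diff_right intro!: eventually_at_rightI[of 0 1])
  then show "((\<lambda>y. (g y - g 0) /\<^sub>R y) \<longlongrightarrow> D) (at_right 0)"
    by (rule LIM_zero_cancel)
  show "\<forall>\<^sub>F y in at_right 0. (g y - g 0) /\<^sub>R y \<in> V"
    using mem V by (auto intro!: eventually_at_rightI[of 0 1] subspace_scale subspace_diff)
qed simp

definition conj_evol :: "'n::finite cmat \<Rightarrow> 'n cmat \<Rightarrow> real \<Rightarrow> 'n cmat" where
  "conj_evol K X t = evol K t ** X ** evol K (- t)"

lemma conj_evol_zero [simp]: "conj_evol K X 0 = X"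
  by (simp add: conj_evol_def)

text \<open>The derivative is again a conjugated curve, started at another matrix, so higher
  derivatives come from iterating this replacement.\<close>

lemma conj_evol_has_vector_derivative:
  "(conj_evol K X has_vector_derivative conj_evol K (cscale (- \<i>) (comm K X)) t) (at t)"
proof -
  have m: "((\<lambda>t. - t) has_vector_derivative -1) (at t)"
    by (auto intro!: derivative_eq_intros)
  have 1: "((\<lambda>t. evol K (- t)) has_vector_derivative cscale \<i> (K ** evol K (- t))) (at t)"
    using vector_diff_chain_at[OF m evol_has_vector_derivative[of K "- t"]] by (simp add: o_def)
  have 2: "((\<lambda>t. evol K t ** X) has_vector_derivative cscale (- \<i>) (K ** evol K t) ** X) (at t)"
    using matrix_has_vector_derivative[OF evol_has_vector_derivative has_vector_derivative_const]
    by simp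
  have d: "((\<lambda>t. evol K t ** X ** evol K (- t)) has_vector_derivative
      evol K t ** X ** cscale \<i> (K ** evol K (- t)) + cscale (- \<i>) (K ** evol K t) ** X ** evol K (- t)) (at t)"
    by (rule matrix_has_vector_derivative[OF 2 1])
  have c: "Y ** K ** evol K u = Y ** evol K u ** K" for Y u
    by (simp add: matrix_mul_assoc[symmetric] evol_commute)
  have "evol K t ** X ** cscale \<i> (K ** evol K (- t)) + cscale (- \<i>) (K ** evol K t) ** X ** evol K (- t)
      = conj_evol K (cscale (- \<i>) (comm K X)) t"
    by (simp add: conj_evol_def comm_def mult_diff_left mult_diff_right cscale_diff matrix_mul_assoc
        evol_commute[symmetric] c)
  with d show ?thesis by (simp only: conj_evol_def[abs_def])
qed

text \<open>Differentiation at 0 from the right. The one-sided form matters where only forward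
  evolutions are known to be reachable.\<close>

lemma comm_mem_if_conj_evol_mem:
  assumes V: "csubspace V" and mem: "\<And>t. t \<ge> 0 \<Longrightarrow> conj_evol K X t \<in> V"
  shows "comm K X \<in> V"
proof -
  have "conj_evol K (cscale (- \<i>) (comm K X)) 0 \<in> V"
    by (rule vector_derivative_in_subspace[OF csubspaceD(1)[OF V] conj_evol_has_vector_derivative mem])
  then have "cscale \<i> (cscale (- \<i>) (comm K X)) \<in> V"
    unfolding conj_evol_zero by (rule csubspaceD(3)[OF V])
  then show ?thesis by simp
qed

lemma norm_conj_evol:
  assumes "hermitian K"
  shows "norm (conj_evol K X t) = norm X"
  using evol_unitary[OF assms] by (simp add: conj_evol_def)

text \<open>The component of the conjugated curve orthogonal to \<open>V\<close> has vanishing Taylor coefficients at 0,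
  and the remainder is controlled because conjugation by unitaries is isometric.\<close>
lemma conj_evol_mem:
  assumes V: "csubspace V" and K: "hermitian K" and inv: "\<And>X. X \<in> V \<Longrightarrow> comm K X \<in> V"
    and X: "X \<in> V"
  shows "conj_evol K X t \<in> V"
proof -
  obtain y z where y: "y \<in> span V" and z: "\<And>w. w \<in> span V \<Longrightarrow> orthogonal z w" and yz: "conj_evol K X t = y + z"
    using orthogonal_subspace_decomp_exists[of V "conj_evol K X t"] by blast
  have spanV: "span V = V"
    using csubspaceD(1)[OF V] by (simp add: span_eq_iff)
  \<comment> \<open>The iterates \<open>Xm m\<close> of \<open>a\<close> stay in \<open>V\<close>,
    and \<open>d m\<close> below is the m-th derivative of the inner product of \<open>z\<close>
    with the curve.\<close>
  define a where "a Y = cscale (- \<i>) (comm K Y)" for Y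
  define Xm where "Xm m = (a ^^ m) X" for m
  have XmV: "Xm m \<in> V" for m
  proof (induction m)
    case (Suc m)
    have "Xm (Suc m) = cscale (- \<i>) (comm K (Xm m))" by (simp add: Xm_def a_def)
    also have "\<dots> \<in> V" by (intro csubspaceD(3)[OF V] inv Suc)
    finally show ?case .
  qed (simp add: Xm_def X)
  have "linear a"
    by (rule linearI) (simp_all add: a_def comm_add cscale_add scaleR_eq_cscale comm_cscale mult.commute)
  then obtain B where B: "B > 0" "\<And>Y. norm (a Y) \<le> norm Y * B"
    using bounded_linear.pos_bounded linear_conv_bounded_linear by blast
  have normXm: "norm (Xm m) \<le> B ^ m * norm X" for m
  proof (induction m)
    case (Suc m)
    have "norm (Xm (Suc m)) \<le> norm (Xm m) * B"
      using B(2)[of "Xm m"] by (simp add: Xm_def)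
    also have "\<dots> \<le> (B ^ m * norm X) * B"
      using Suc B(1) by (intro mult_right_mono) auto
    finally show ?case by (simp add: mult_ac)
  qed (simp add: Xm_def)
  define d where "d m s = inner z (conj_evol K (Xm m) s)" for m s
  have "(d m has_real_derivative d (Suc m) s) (at s)" for m s
    using bounded_linear.has_vector_derivative[OF bounded_linear_inner_right
        conj_evol_has_vector_derivative[of K "Xm m" s], of z]
    by (simp add: d_def[abs_def] has_real_derivative_iff_has_vector_derivative Xm_def a_def)
  then have Taylor: "\<exists>u. \<bar>u\<bar> \<le> \<bar>t\<bar> \<and> d 0 t = (\<Sum>m<n. (d m 0 / fact m) * t ^ m) + (d n u / fact n) * t ^ n" for n
    using Maclaurin_all_le[of d "d 0" t n] by blast
  have d0: "d m 0 = 0" for m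
    using z[of "Xm m"] XmV[of m] by (simp add: d_def spanV orthogonal_def)
  have bound: "\<bar>d 0 t\<bar> \<le> norm z * norm X * ((B * \<bar>t\<bar>) ^ n / fact n)" for n
  proof -
    obtain u where u: "d 0 t = (d n u / fact n) * t ^ n"
      using Taylor[of n] by (auto simp: d0)
    have "\<bar>d n u\<bar> \<le> norm z * norm (conj_evol K (Xm n) u)"
      unfolding d_def by (rule Cauchy_Schwarz_ineq2)
    also have "\<dots> \<le> norm z * (B ^ n * norm X)"
      unfolding norm_conj_evol[OF K] by (intro mult_left_mono normXm) simp
    finally have "\<bar>d n u\<bar> * (\<bar>t\<bar> ^ n / fact n) \<le> norm z * (B ^ n * norm X) * (\<bar>t\<bar> ^ n / fact n)"
      by (rule mult_right_mono) simp
    then show ?thesis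
      unfolding u by (simp add: abs_mult power_abs power_mult_distrib mult_ac)
  qed
  have "(\<lambda>n. norm z * norm X * ((B * \<bar>t\<bar>) ^ n / fact n)) \<longlonglongrightarrow> norm z * norm X * 0"
    using summable_LIMSEQ_zero[OF summable_exp_generic[of "B * \<bar>t\<bar>"]]
    by (intro tendsto_mult tendsto_const) (simp add: divide_inverse mult.commute)
  then have "\<bar>d 0 t\<bar> \<le> norm z * norm X * 0"
    by (rule LIMSEQ_le_const) (use bound in blast)
  then have "inner z (y + z) = 0"
    by (simp add: d_def Xm_def yz)
  moreover have "inner z y = 0"
    using z[OF y] by (simp add: orthogonal_def)
  ultimately have "z = 0" by (simp add: inner_add_right)
  then show ?thesis using yz y spanV by simp
qed

section \<open>Determinants of evolutions\<close>

lemma det_evol_has_vector_derivative_zero: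
  fixes H :: "'n::finite cmat"
  shows "((\<lambda>t. det (evol H t)) has_vector_derivative (- \<i> * trace H)) (at 0)"
proof -
  let ?f = "\<lambda>z. det (mexp (cscale z H))"
  have one: "mexp (0 :: 'n cmat) = mat 1"
    using evol_zero[of H] by (simp add: evol_def)
  have "(?f has_field_derivative (\<Sum>p\<in>{p. p permutes UNIV}. of_int (sign p) *
      (\<Sum>i\<in>UNIV. (H ** mexp (cscale 0 H)) $ i $ p i * (\<Prod>j\<in>UNIV - {i}. mexp (cscale 0 H) $ j $ p j)))) (at 0)"
    unfolding det_def
    by (intro DERIV_sum DERIV_cmult has_field_derivative_prod mexp_nth_DERIV(1))
  \<comment> \<open>Jacobi's formula at the identity matrix: only the identity permutation
    contributes.\<close>
  also have "(\<Sum>p\<in>{p. p permutes UNIV}. of_int (sign p) *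
      (\<Sum>i\<in>UNIV. (H ** mexp (cscale 0 H)) $ i $ p i * (\<Prod>j\<in>UNIV - {i}. mexp (cscale 0 H) $ j $ p j)))
      = (\<Sum>p\<in>{p. p permutes (UNIV :: 'n set)}. if p = id then trace H else 0)"
  proof (rule sum.cong[OF refl])
    fix p :: "'n \<Rightarrow> 'n" assume p: "p \<in> {p. p permutes UNIV}"
    show "of_int (sign p) * (\<Sum>i\<in>UNIV. (H ** mexp (cscale 0 H)) $ i $ p i *
        (\<Prod>j\<in>UNIV - {i}. mexp (cscale 0 H) $ j $ p j)) = (if p = id then trace H else 0)"
    proof (cases "p = id")
      case True
      have "(mat 1 :: 'n cmat) $ j $ j = 1" for j by (simp add: mat_def)
      then show ?thesis using True by (simp add: one trace_def sign_id)
    next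
      case False
      have "(\<Prod>j\<in>UNIV - {i}. (mat 1 :: 'n cmat) $ j $ p j) = 0" for i
      proof (rule prod_zero)
        \<comment> \<open>Both \<open>k\<close> and \<open>p k\<close> are moved by
          \<open>p\<close>, so a zero factor survives even when the factor of \<open>i\<close> is
          left out.\<close>
        obtain k where k: "p k \<noteq> k" using False by (auto simp: fun_eq_iff)
        have "p (p k) \<noteq> p k"
          using k p by (metis mem_Collect_eq permutes_inj inj_eq)
        then show "\<exists>j\<in>UNIV - {i}. (mat 1 :: 'n cmat) $ j $ p j = 0"
          using k by (intro bexI[of _ "if k = i then p k else k"]) (auto simp: mat_def)
      qed simp
      then show ?thesis
        using False by (simp only: cscale_zero one mult_zero_right sum.neutral_const if_False)
    qed
  qed
  also have "\<dots> = trace H"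
    by (simp add: sum.delta' permutes_id)
  finally have f: "(?f has_field_derivative trace H) (at (- \<i> * complex_of_real 0))"
    by simp
  have "((\<lambda>t. - \<i> * complex_of_real t) has_vector_derivative - \<i>) (at 0)"
    by (auto intro!: derivative_eq_intros)
  from field_vector_diff_chain_at[OF this f] show ?thesis
    by (simp add: evol_def o_def)
qed

text \<open>The group law and multiplicativity of the determinant transport the vanishing derivative
  from 0 to every time.\<close>

lemma det_evol_traceless:
  assumes "trace H = 0"
  shows "det (evol H t) = 1"
proof -
  have "((\<lambda>t. det (evol H t)) has_vector_derivative 0) (at t)" for t
  proof -
    have 1: "((\<lambda>s. s - t) has_vector_derivative 1) (at t)"
      by (auto intro!: derivative_eq_intros)
    have "((\<lambda>h. det (evol H h)) has_vector_derivative 0) (at (t - t))"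
      using det_evol_has_vector_derivative_zero[of H] by (simp add: assms)
    then have 2: "((\<lambda>h. det (evol H h) * det (evol H t)) has_vector_derivative 0) (at (t - t))"
      using has_vector_derivative_mult_left by fastforce
    show ?thesis
      using vector_diff_chain_at[OF 1 2] by (simp add: o_def det_mul[symmetric] evol_add[symmetric])
  qed
  from constant_if_vector_derivative_zero[OF this, of t 0] show ?thesis by simp
qed

section \<open>Controllability turns invariant subspaces into ideals\<close>

lemma Jprod_unitary:
  assumes "hermitian H1" "hermitian H2"
  shows "Jprod H1 H2 n s \<in> unitary_group"
  by (induction n) (auto simp: assms evol_unitary unitary_mult)

lemma Jprod_conj_mem:
  assumes V: "csubspace V" and H: "hermitian H1" "hermitian H2"
    and inv: "\<And>X. X \<in> V \<Longrightarrow> comm H1 X \<in> V" "\<And>X. X \<in> V \<Longrightarrow> comm H2 X \<in> V" and "X \<in> V"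
  shows "Jprod H1 H2 n s ** X ** adjoint (Jprod H1 H2 n s) \<in> V"
proof (induction n)
  case (Suc n)
  define K where "K = (if odd (Suc n) then H1 else H2)"
  have K: "hermitian K" "\<And>X. X \<in> V \<Longrightarrow> comm K X \<in> V"
    using H inv by (auto simp: K_def)
  have "Jprod H1 H2 (Suc n) s ** X ** adjoint (Jprod H1 H2 (Suc n) s) =
      conj_evol K (Jprod H1 H2 n s ** X ** adjoint (Jprod H1 H2 n s)) (s (Suc n))"
    by (simp add: conj_evol_def adjoint_mult adjoint_evol[OF H(1)] adjoint_evol[OF H(2)] matrix_mul_assoc K_def)
  also have "\<dots> \<in> V"
    by (rule conj_evol_mem[OF V K Suc])
  finally show ?case .
qed (simp add: assms)

lemma U_controllableD:
  assumes "U_controllable H1 H2" "U \<in> unitary_group"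
  obtains n s where "U = Jprod H1 H2 n s"
proof -
  obtain n where "Jset n H1 H2 = unitary_group"
    using assms(1) by (auto simp: U_controllable_def)
  then have "U \<in> Jset n H1 H2" using assms(2) by simp
  then show ?thesis using that by (auto simp: Jset_def)
qed

lemma hermitian_decomp:
  obtains A B where "hermitian A" "hermitian B" "K = A + cscale \<i> B"
proof
  show "hermitian (cscale (1 / 2) (K + adjoint K))" "hermitian (cscale (- \<i> / 2) (K - adjoint K))"
    by (simp_all add: hermitian_def vec_eq_iff algebra_simps)
  show "K = cscale (1 / 2) (K + adjoint K) + cscale \<i> (cscale (- \<i> / 2) (K - adjoint K))"
    by (simp add: vec_eq_iff algebra_simps flip: distrib_left)
qed

text \<open>For Hermitian \<open>K\<close> every \<open>evol K t\<close> is unitary, hence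
  reachable, so it conjugates \<open>V\<close> into itself; differentiate at 0. A general
  \<open>K\<close> splits into Hermitian parts.\<close>

lemma controllable_ideal:
  assumes H: "hermitian H1" "hermitian H2" and ctrl: "U_controllable H1 H2" and V: "csubspace V"
    and inv: "\<And>X. X \<in> V \<Longrightarrow> comm H1 X \<in> V" "\<And>X. X \<in> V \<Longrightarrow> comm H2 X \<in> V" and "X \<in> V"
  shows "comm K X \<in> V"
proof -
  have herm: "comm K X \<in> V" if "hermitian K" for K
  proof (rule comm_mem_if_conj_evol_mem[OF V])
    fix t
    have "evol K t \<in> unitary_group" using \<open>hermitian K\<close> by (rule evol_unitary)
    then obtain n s where "evol K t = Jprod H1 H2 n s"
      by (rule U_controllableD[OF ctrl])
    then show "conj_evol K X t \<in> V"
      using Jprod_conj_mem[OF V H inv \<open>X \<in> V\<close>, of n s] by (simp add: conj_evol_def adjoint_evol[OF that, symmetric])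
  qed
  obtain A B where "hermitian A" "hermitian B" "K = A + cscale \<i> B"
    by (rule hermitian_decomp)
  then show ?thesis
    using herm csubspaceD(3,4)[OF V] by (simp add: comm_add_left comm_cscale_left)
qed

lemma Jprod_traceless:
  assumes "trace H1 = 0" "trace H2 = 0"
  shows "det (Jprod H1 H2 n s) = 1"
  by (induction n) (simp_all add: det_mul det_evol_traceless assms)

text \<open>Otherwise every reachable operator would have determinant 1, but the reflection in one
  coordinate has determinant -1.\<close>

lemma controllable_trace:
  fixes H1 H2 :: "'n::finite cmat"
  assumes "U_controllable H1 H2"
  shows "trace H1 \<noteq> 0 \<or> trace H2 \<noteq> 0"
proof (rule ccontr)
  assume tr: "\<not> (trace H1 \<noteq> 0 \<or> trace H2 \<noteq> 0)"
  obtain a :: 'n where True by simp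
  define U :: "'n cmat" where "U = (\<chi> i j. if i = j then (if i = a then - 1 else 1) else 0)"
  have "adjoint U = U" by (simp add: vec_eq_iff U_def)
  moreover have "(U ** U) $ i $ j = mat 1 $ i $ j" for i j
  proof -
    have "(U ** U) $ i $ j = (\<Sum>k\<in>UNIV. if k = i then (if i = j then 1 else 0) else 0)"
      unfolding matrix_matrix_mult_def vec_lambda_beta by (intro sum.cong) (auto simp: U_def)
    then show ?thesis by (simp add: mat_def)
  qed
  then have "U ** U = mat 1" by (rule mat_eqI)
  ultimately have "U \<in> unitary_group" by (simp add: unitary_group_def)
  then obtain n s where "U = Jprod H1 H2 n s"
    using U_controllableD[OF assms] by blast
  then have "det U = 1" using tr Jprod_traceless by auto
  moreover have "det U = (\<Prod>i\<in>UNIV. if i = a then - 1 else 1)"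
    by (subst det_diagonal) (auto simp: U_def)
  moreover have "\<dots> = (- 1 :: complex)" by (simp add: prod.delta)
  ultimately show False by simp
qed

lemma controllable_imp_rank_cond:
  fixes H1 H2 :: "'n::finite cmat"
  assumes N: "CARD('n) \<ge> 2" and H: "hermitian H1" "hermitian H2" and ctrl: "U_controllable H1 H2"
  shows "rank_cond H1 H2"
proof (rule rank_condI)
  note ideal = controllable_ideal[OF H ctrl]
  obtain a b :: 'n where ab: "a \<noteq> b"
  proof -
    have "\<not> (\<forall>x y::'n. x = y)"
    proof
      assume "\<forall>x y::'n. x = y"
      then have "(UNIV :: 'n set) = {undefined}" by auto
      then have "CARD('n) = card {undefined :: 'n}" by (rule arg_cong)
      then show False using N by simp
    qed
    then show ?thesis using that by blast
  qed
  fix V :: "'n cmat set"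
  assume V: "csubspace V" and HV: "H1 \<in> V" "H2 \<in> V"
    and inv: "\<And>X. X \<in> V \<Longrightarrow> comm H1 X \<in> V" "\<And>X. X \<in> V \<Longrightarrow> comm H2 X \<in> V"
  note V' = csubspaceD[OF V]
  have "\<exists>X\<in>V. X \<noteq> cscale (X $ a $ a) (mat 1)"
  proof (rule ccontr)
    assume "\<not> ?thesis"
    then have scalar: "H1 = cscale (H1 $ a $ a) (mat 1)" "H2 = cscale (H2 $ a $ a) (mat 1)"
      using HV by blast+
    have comm0: "comm H1 X = 0" "comm H2 X = 0" for X
      by (subst scalar, simp add: comm_def)+
    \<comment> \<open>With scalar \<open>H1\<close> and \<open>H2\<close> every complex subspace
      would be invariant and thus an ideal; the line through \<open>munit a b\<close> is not
      one.\<close>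
    define W where "W = range (\<lambda>c. cscale c (munit a b))"
    have W: "csubspace W"
    proof (rule csubspaceI)
      have "cscale 0 (munit a b) \<in> W" unfolding W_def by (rule rangeI)
      then show "0 \<in> W" by simp
    qed (auto simp: W_def simp flip: cscale_add_left)
    have "comm (munit b a) (munit a b) \<in> W"
    proof (rule ideal[OF W])
      show "munit a b \<in> W" unfolding W_def by (rule image_eqI[of _ _ 1]) simp_all
    qed (simp_all add: comm0 csubspaceD(2)[OF W])
    then obtain c where "comm (munit b a) (munit a b) = cscale c (munit a b)"
      by (auto simp: W_def)
    then have "comm (munit b a) (munit a b) $ a $ a = cscale c (munit a b) $ a $ a" by simp
    then show False using ab by (simp add: comm_munit_nth)
  qed
  then obtain X where X: "X \<in> V" "X \<noteq> cscale (X $ a $ a) (mat 1)" by blast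
  have off: "munit k l \<in> V" if "k \<noteq> l" for k l
    by (rule ideal_munit[OF V _ X that]) (rule ideal[OF V inv])
  have "munit k k - munit l l \<in> V" for k l
  proof (cases "k = l")
    case False
    have "comm (munit k l) (munit l k) \<in> V"
      by (rule ideal[OF V inv]) (use off False in auto)
    moreover have "comm (munit k l) (munit l k) = munit k k - munit l l"
      by (intro mat_eqI) (simp add: comm_munit_nth)
    ultimately show ?thesis by simp
  qed (simp add: V')
  then show "V = UNIV"
    using csubspace_eq_UNIV[OF V off] controllable_trace[OF ctrl] HV by blast
qed

section \<open>Sufficiency of the rank condition\<close>

lemma Jprod_cong: "(\<And>j. j \<in> {1..n} \<Longrightarrow> s j = s' j) \<Longrightarrow> Jprod H1 H2 n s = Jprod H1 H2 n s'"
  by (induction n) simp_all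

lemma Jset_0 [simp]: "Jset 0 H1 H2 = {mat 1}"
  by (auto simp: Jset_def)

lemma Jset_SucI:
  assumes "t \<ge> 0" "g \<in> Jset n H1 H2"
  shows "evol (if odd (Suc n) then H1 else H2) t ** g \<in> Jset (Suc n) H1 H2"
proof -
  obtain s where s: "g = Jprod H1 H2 n s" "\<forall>j\<in>{1..n}. s j \<ge> 0"
    using assms(2) by (auto simp: Jset_def)
  have 1: "Jprod H1 H2 (Suc n) (s(Suc n := t)) = evol (if odd (Suc n) then H1 else H2) t ** g"
    unfolding s(1) Jprod.simps using Jprod_cong[of n "s(Suc n := t)" s H1 H2] by simp
  have 2: "\<forall>j\<in>{1..Suc n}. (s(Suc n := t)) j \<ge> 0"
    using s(2) assms(1) by auto
  show ?thesis
    unfolding Jset_def mem_Collect_eq by (rule exI, rule conjI[OF 1[symmetric] 2])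
qed

lemma Jset_SucE:
  assumes "g \<in> Jset (Suc n) H1 H2"
  obtains t h where "t \<ge> 0" "h \<in> Jset n H1 H2" "g = evol (if odd (Suc n) then H1 else H2) t ** h"
proof -
  obtain s where s: "g = Jprod H1 H2 (Suc n) s" "\<forall>j\<in>{1..Suc n}. s j \<ge> 0"
    using assms by (auto simp: Jset_def)
  have "Jprod H1 H2 n s \<in> Jset n H1 H2"
    using s(2) by (auto simp: Jset_def)
  then show ?thesis using that[of "s (Suc n)"] s by simp
qed

lemma Jset_mono:
  assumes "m \<le> n" "g \<in> Jset m H1 H2"
  shows "g \<in> Jset n H1 H2"
  using assms(1)
proof (induction n rule: dec_induct)
  case (step n)
  then show ?case using Jset_SucI[of 0 g n H1 H2] by (simp split: if_splits)
qed (rule assms(2))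

text \<open>The factors alternate, so of two new slots one can take \<open>H\<close> and the other
  gets duration 0.\<close>

lemma evol_mult_Jset:
  assumes "t \<ge> 0" "g \<in> Jset n H1 H2" "H \<in> {H1, H2}"
  shows "evol H t ** g \<in> Jset (n + 2) H1 H2"
proof (cases "H = (if odd (Suc n) then H1 else H2)")
  case True
  then show ?thesis
    using Jset_mono[OF _ Jset_SucI[OF assms(1,2)], of "n + 2"] by simp
next
  case False
  then have "H = (if odd (Suc (Suc n)) then H1 else H2)" using assms(3) by auto
  then show ?thesis
    using Jset_SucI[OF assms(1) Jset_mono[OF _ assms(2), of "Suc n"]] by simp
qed

text \<open>Each factor of \<open>h\<close> costs two slots. The length depends only on
  \<open>m\<close> and \<open>n\<close>, which later gives bounds uniform in the operators.\<close>

lemma Jset_mult: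
  assumes "g \<in> Jset m H1 H2" "h \<in> Jset n H1 H2"
  shows "h ** g \<in> Jset (m + 2 * n) H1 H2"
  using assms(2)
proof (induction n arbitrary: h)
  case 0
  then show ?case using assms(1) by simp
next
  case (Suc n)
  obtain t h' where h: "t \<ge> 0" "h' \<in> Jset n H1 H2" "h = evol (if odd (Suc n) then H1 else H2) t ** h'"
    by (rule Jset_SucE[OF Suc.prems])
  have "evol (if odd (Suc n) then H1 else H2) t ** (h' ** g) \<in> Jset (m + 2 * n + 2) H1 H2"
    by (rule evol_mult_Jset[OF h(1) Suc.IH[OF h(2)]]) auto
  then show ?case by (simp add: h(3) matrix_mul_assoc del: even_Suc)
qed

definition reach :: "'n::finite cmat \<Rightarrow> 'n cmat \<Rightarrow> 'n cmat set" where
  "reach H1 H2 = (\<Union>n. Jset n H1 H2)"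

lemma reach_mult: "g \<in> reach H1 H2 \<Longrightarrow> h \<in> reach H1 H2 \<Longrightarrow> g ** h \<in> reach H1 H2"
  unfolding reach_def using Jset_mult[of h _ H1 H2 g] by auto

lemma reach_one [simp]: "mat 1 \<in> reach H1 H2"
  unfolding reach_def by (auto intro!: exI[of _ 0])

lemma reach_evol: "t \<ge> 0 \<Longrightarrow> H \<in> {H1, H2} \<Longrightarrow> evol H t \<in> reach H1 H2"
  unfolding reach_def using evol_mult_Jset[of t "mat 1" 0 H1 H2 H] by auto

lemma reach_mpow: "g \<in> reach H1 H2 \<Longrightarrow> mpow g k \<in> reach H1 H2"
  by (induction k) (simp_all add: reach_mult)

lemma Jset_unitary:
  assumes "hermitian H1" "hermitian H2"
  shows "Jset n H1 H2 \<subseteq> unitary_group"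
  using Jprod_unitary[OF assms] by (auto simp: Jset_def)

lemma reach_unitary:
  assumes "hermitian H1" "hermitian H2" "g \<in> reach H1 H2"
  shows "g \<in> unitary_group"
  using Jset_unitary[OF assms(1,2)] assms(3) by (auto simp: reach_def)

lemma mpow_unitary: "U \<in> unitary_group \<Longrightarrow> mpow U k \<in> unitary_group"
  by (induction k) (simp_all add: unitary_mult)

lemma mpow_add: "mpow A (j + k) = mpow A j ** mpow A k"
  by (induction j) (simp_all add: matrix_mul_assoc)

text \<open>Powers of a unitary recur to the identity, so the semigroup of reachable operators contains
  approximate inverses.\<close>
lemma ex_mpow_near_adjoint:
  fixes U :: "'n::finite cmat"
  assumes U: "U \<in> unitary_group" and "e > 0"
  shows "\<exists>k. norm (mpow U k - adjoint U) < e"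
proof -
  have "\<forall>k. mpow U k \<in> unitary_group" using mpow_unitary[OF U] by blast
  then obtain l r where r: "strict_mono r" "((\<lambda>k. mpow U k) \<circ> r) \<longlonglongrightarrow> l"
    using compact_unitary_group[unfolded compact_def] by meson
  then have "Cauchy (\<lambda>k. mpow U (r k))"
    using LIMSEQ_imp_Cauchy[of "(\<lambda>k. mpow U k) \<circ> r"] by (simp add: o_def)
  then obtain M where M: "\<forall>m\<ge>M. \<forall>n\<ge>M. norm (mpow U (r m) - mpow U (r n)) < e"
    using CauchyD[OF _ \<open>e > 0\<close>] by blast
  \<comment> \<open>Two close powers of \<open>U\<close> differ by an exponent \<open>Suc k\<close>;
    cancelling the smaller power and one further \<open>U\<close> puts \<open>mpow U k\<close> near
    the inverse.\<close>
  have "r M < r (Suc M)" using r(1) by (simp add: strict_mono_def)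
  then obtain k where k: "r (Suc M) = r M + Suc k"
    using less_imp_Suc_add by auto
  have "norm (mpow U k - adjoint U) = norm (mpow U (r M) ** (U ** (mpow U k - adjoint U)))"
    using U mpow_unitary[OF U] by simp
  also have "mpow U (r M) ** (U ** (mpow U k - adjoint U)) = mpow U (r (Suc M)) - mpow U (r M)"
    by (simp add: k mpow_add mult_diff_right unitary_groupD[OF U] matrix_mul_assoc[symmetric] mpow_commute)
      (simp add: matrix_mul_assoc mpow_commute)
  also have "norm \<dots> < e" using M by simp
  finally show ?thesis by blast
qed

lemma reach_near_adjoint:
  assumes "hermitian H1" "hermitian H2" "P \<in> reach H1 H2" "e > 0"
  obtains Q where "Q \<in> reach H1 H2" "norm (Q - adjoint P) < e"
  using ex_mpow_near_adjoint[OF reach_unitary[OF assms(1-3)] assms(4)] reach_mpow[OF assms(3)] by blast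

section \<open>Generators conjugated by reachable operators\<close>

definition reach_conj :: "'n::finite cmat \<Rightarrow> 'n cmat \<Rightarrow> 'n cmat set" where
  "reach_conj H1 H2 = {adjoint P ** H ** P | P H. P \<in> reach H1 H2 \<and> H \<in> {H1, H2}}"

lemma evol_uminus: "evol (- H) t = evol H (- t)"
  by (simp add: evol_def)

text \<open>Right multiplication of \<open>P\<close> by a forward evolution stays reachable, so the
  span is invariant under conjugations and, after differentiation, under commutators with both
  operators.\<close>

lemma csubspace_hull_reach_conj:
  assumes H: "hermitian H1" "hermitian H2" and rank: "rank_cond H1 H2"
  shows "csubspace hull (reach_conj H1 H2) = UNIV"
proof (rule rank_cond_UNIV[OF rank csubspace_hull])
  let ?L = "csubspace hull (reach_conj H1 H2)"
  have gen: "adjoint P ** K ** P \<in> ?L" if "P \<in> reach H1 H2" "K \<in> {H1, H2}" for P K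
    using that by (intro hull_inc) (auto simp: reach_conj_def)
  show "H1 \<in> ?L" "H2 \<in> ?L"
    using gen[OF reach_one, of H1] gen[OF reach_one, of H2] by simp_all
  have "comm K X \<in> ?L" if K: "K \<in> {H1, H2}" and "X \<in> ?L" for K X
  proof -
    have hK: "hermitian K" using K H by auto
    \<comment> \<open>Replacing \<open>P\<close> by \<open>P ** evol K t\<close> puts
      \<open>evol K (- t)\<close> on the left, which is forward conjugation by
      \<open>- K\<close>.\<close>
    have "comm (- K) X \<in> ?L"
    proof (rule comm_mem_if_conj_evol_mem[OF csubspace_hull])
      fix t :: real assume t: "t \<ge> 0"
      show "conj_evol (- K) X t \<in> ?L"
      proof (rule csubspace_hull_invariant[OF _ _ _ _ \<open>X \<in> ?L\<close>])
        fix Y assume "Y \<in> reach_conj H1 H2"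
        then obtain P K' where P: "P \<in> reach H1 H2" "K' \<in> {H1, H2}" "Y = adjoint P ** K' ** P"
          by (auto simp: reach_conj_def)
        have "conj_evol (- K) Y t = adjoint (P ** evol K t) ** K' ** (P ** evol K t)"
          by (simp add: conj_evol_def evol_uminus P(3) adjoint_mult adjoint_evol[OF hK] matrix_mul_assoc)
        also have "\<dots> \<in> ?L"
          by (intro gen reach_mult P(1,2) reach_evol t K)
        finally show "conj_evol (- K) Y t \<in> ?L" .
      qed (simp_all add: conj_evol_def matrix_add_ldistrib matrix_add_rdistrib)
    qed
    then have "cscale (- 1) (comm (- K) X) \<in> ?L"
      by (rule csubspaceD(3)[OF csubspace_hull])
    then show ?thesis by (simp add: comm_def)
  qed
  then show "comm H1 X \<in> ?L" "comm H2 X \<in> ?L" if "X \<in> ?L" for X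
    using that by simp_all
qed

text \<open>Passage from complex to real combinations: twice the Hermitian part of a complex
  multiple of a Hermitian generator is a real multiple of it, and \<open>W\<close> is a complex
  subspace.\<close>

lemma hermitian_mem_span:
  assumes herm: "\<And>X. X \<in> G \<Longrightarrow> hermitian X" and full: "csubspace hull G = UNIV" and X: "hermitian X"
  shows "X \<in> span G"
proof -
  define W where "W = {X. \<forall>c. cscale c X + adjoint (cscale c X) \<in> span G}"
  have "csubspace W"
  proof (rule csubspaceI)
    fix X Y assume "X \<in> W" "Y \<in> W"
    then have "(cscale c X + adjoint (cscale c X)) + (cscale c Y + adjoint (cscale c Y)) \<in> span G" for c
      using span_add[of "cscale c X + adjoint (cscale c X)" G "cscale c Y + adjoint (cscale c Y)"]
      by (simp add: W_def del: adjoint_cscale)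
    then show "X + Y \<in> W"
      by (simp add: W_def cscale_add adjoint_add algebra_simps)
  next
    fix c X assume "X \<in> W"
    then have "\<forall>d. cscale (d * c) X + adjoint (cscale (d * c) X) \<in> span G"
      unfolding W_def by blast
    then show "cscale c X \<in> W" by (simp add: W_def mult.commute)
  qed (simp add: W_def span_zero)
  moreover have "G \<subseteq> W"
  proof
    fix Y assume Y: "Y \<in> G"
    have "cscale c Y + adjoint (cscale c Y) = (2 * Re c) *\<^sub>R Y" for c
      using herm[OF Y] by (simp add: hermitian_def scaleR_eq_cscale cscale_add_left[symmetric]
          complex_add_cnj del: cscale_add_left)
    then show "Y \<in> W" using span_scale[OF span_base[OF Y]] by (simp add: W_def)
  qed
  ultimately have "csubspace hull G \<subseteq> W" by (intro hull_minimal)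
  then have "X \<in> W" using full by blast
  then have "\<forall>c. cscale c X + adjoint (cscale c X) \<in> span G"
    unfolding W_def by (rule CollectD)
  then have "cscale (1 / 2) X + adjoint (cscale (1 / 2) X) \<in> span G" ..
  moreover have "cscale (1 / 2) X + adjoint (cscale (1 / 2) X) = X"
    using X by (simp add: hermitian_def cscale_add_left[symmetric])
  ultimately show ?thesis by simp
qed

text \<open>Brouwer's theorem makes the local surjectivity of a map with derivative \<open>id\<close> stable under
  uniform perturbations.\<close>
lemma perturbed_local_surjection:
  fixes f :: "'a::euclidean_space \<Rightarrow> 'a"
  assumes f: "(f has_derivative (\<lambda>x. x)) (at 0)" and "e > 0"
  obtains d where "0 < d" "d < e"
    "\<forall>h. continuous_on (cball 0 d) h \<longrightarrow> (\<forall>x\<in>cball 0 d. norm (h x - f x) \<le> d / 4)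
      \<longrightarrow> cball (f 0) (d / 4) \<subseteq> h ` cball 0 d"
proof -
  obtain d0 where d0: "d0 > 0" "\<And>y. norm y < d0 \<Longrightarrow> norm (f y - f 0 - y) \<le> norm y / 4"
    using f unfolding has_derivative_at_alt by (auto dest!: spec[of _ "1 / 4"])
  define d where "d = min d0 e / 2"
  have d: "0 < d" "d < e" "d < d0" using d0(1) \<open>e > 0\<close> by (auto simp: d_def)
  show ?thesis
  proof (rule that[OF d(1,2)], intro allI impI subsetI)
    fix h :: "'a \<Rightarrow> 'a" and y assume cont: "continuous_on (cball 0 d) h"
      and h: "\<forall>x\<in>cball 0 d. norm (h x - f x) \<le> d / 4"
      and y: "y \<in> cball (f 0) (d / 4)"
    have "\<exists>x\<in>cball 0 d. h x = y"
    proof (rule brouwer_surjective_cball[OF cont d(1) y])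
      fix u x :: 'a assume u: "u \<in> cball (f 0) (d / 4)" and x: "x \<in> cball 0 d"
      \<comment> \<open>A fixed point of this map in \<open>x\<close> solves \<open>h x = u\<close>.
        The three terms are the target offset, the linearization error and the perturbation, each at
        most \<open>d / 4\<close>.\<close>
      have "u + (x - h x) = (u - f 0) - (f x - f 0 - x) - (h x - f x)" by simp
      also have "norm \<dots> \<le> norm (u - f 0) + norm (f x - f 0 - x) + norm (h x - f x)"
        by (meson add_right_mono norm_triangle_ineq4 order_trans)
      also have "\<dots> \<le> d / 4 + d / 4 + d / 4"
        using u x bspec[OF h x] d0(2)[of x] d by (auto simp: dist_norm norm_minus_commute)
      finally show "u + (x - h x) \<in> cball 0 d" using d(1) by simp
    qed
    then show "y \<in> h ` cball 0 d" by blast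
  qed
qed

section \<open>Products of factors indexed by a list\<close>

primrec lprod :: "('b \<Rightarrow> 'n::finite cmat) \<Rightarrow> 'b list \<Rightarrow> 'n cmat" where
  "lprod f [] = mat 1"
| "lprod f (b # bs) = f b ** lprod f bs"

lemma lprod_unitary: "(\<And>b. b \<in> set bs \<Longrightarrow> f b \<in> unitary_group) \<Longrightarrow> lprod f bs \<in> unitary_group"
  by (induction bs) (simp_all add: unitary_mult)

lemma lprod_one: "(\<And>b. b \<in> set bs \<Longrightarrow> f b = mat 1) \<Longrightarrow> lprod f bs = mat 1"
  by (induction bs) simp_all

text \<open>Where all factors equal 1, the product rule loses its accompanying factors and only a
  sum remains.\<close>

lemma lprod_has_derivative:
  assumes "\<And>b. b \<in> set bs \<Longrightarrow> ((\<lambda>x. f b x) has_derivative f' b) (at x)" "\<And>b. b \<in> set bs \<Longrightarrow> f b x = mat 1"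
  shows "((\<lambda>x. lprod (\<lambda>b. f b x) bs) has_derivative (\<lambda>h. \<Sum>b\<leftarrow>bs. f' b h)) (at x)"
  using assms
proof (induction bs)
  case (Cons b bs)
  have 1: "(f b has_derivative f' b) (at x)" using Cons.prems(1) by simp
  have 2: "((\<lambda>x. lprod (\<lambda>b. f b x) bs) has_derivative (\<lambda>h. \<Sum>b\<leftarrow>bs. f' b h)) (at x)"
    using Cons by simp
  have "lprod (\<lambda>b. f b x) bs = mat 1" using Cons.prems(2) by (intro lprod_one) simp
  moreover have "f b x = mat 1" using Cons.prems(2) by simp
  ultimately show ?case
    using bounded_bilinear.FDERIV[OF bounded_bilinear_mult 1 2] by (simp add: add.commute)
qed simp

lemma lprod_continuous_on:
  assumes "\<And>b. b \<in> set bs \<Longrightarrow> continuous_on S (\<lambda>x. f b x)"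
  shows "continuous_on S (\<lambda>x. lprod (\<lambda>b. f b x) bs)"
  using assms by (induction bs) (auto intro!: continuous_intros)

text \<open>Telescoping: unitary factors preserve the norm, so the individual errors simply add
  up.\<close>

lemma lprod_diff_bound:
  fixes e :: real
  assumes "\<And>b. b \<in> set bs \<Longrightarrow> f b \<in> unitary_group \<and> g b \<in> unitary_group \<and> norm (f b - g b) \<le> e"
  shows "norm (lprod f bs - lprod g bs) \<le> length bs * e"
  using assms
proof (induction bs)
  case (Cons b bs)
  have U: "f b \<in> unitary_group" "lprod g bs \<in> unitary_group"
    using Cons.prems by (auto intro: lprod_unitary)
  have "lprod f (b # bs) - lprod g (b # bs) = f b ** (lprod f bs - lprod g bs) + (f b - g b) ** lprod g bs"
    by (simp add: mult_diff_left mult_diff_right)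
  also have "norm \<dots> \<le> norm (lprod f bs - lprod g bs) + norm (f b - g b)"
    using norm_triangle_ineq[of "f b ** (lprod f bs - lprod g bs)" "(f b - g b) ** lprod g bs"] U by simp
  also have "\<dots> \<le> length bs * e + e"
    using Cons by (intro add_mono) auto
  finally show ?case by (simp add: algebra_simps)
qed simp

lemma lprod_Jset:
  assumes "\<And>b. b \<in> set bs \<Longrightarrow> \<exists>m. \<forall>x\<in>S. f b x \<in> Jset m H1 H2"
  shows "\<exists>m. \<forall>x\<in>S. lprod (\<lambda>b. f b x) bs \<in> Jset m H1 H2"
  using assms
proof (induction bs)
  case Nil
  show ?case by (rule exI[of _ 0]) simp
next
  case (Cons b bs)
  obtain m1 where m1: "\<forall>x\<in>S. f b x \<in> Jset m1 H1 H2"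
    using Cons.prems[of b] by auto
  obtain m2 where m2: "\<forall>x\<in>S. lprod (\<lambda>b. f b x) bs \<in> Jset m2 H1 H2"
    using Cons.IH Cons.prems by auto
  have "\<forall>x\<in>S. lprod (\<lambda>b. f b x) (b # bs) \<in> Jset (m2 + 2 * m1) H1 H2"
    using m1 m2 by (auto intro: Jset_mult)
  then show ?case by (rule exI)
qed

text \<open>A unitary of the form \<open>(1 + K) g\<close> with \<open>g\<close> unitary and \<open>K\<close> small Hermitian equals \<open>g\<close>
  (uniqueness of the polar decomposition): the factor \<open>1 + K\<close> turns a map into the unitary group
  into a map between Euclidean spaces of equal dimension.\<close>
lemma small_hermitian_unitary:
  obtains r where "r > 0"
    "\<And>K :: 'n::finite cmat. \<lbrakk>hermitian K; norm K < r; mat 1 + K \<in> unitary_group\<rbrakk> \<Longrightarrow> K = 0"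
proof -
  obtain C where C: "C > 0" "\<And>(A :: 'n cmat) (B :: 'n cmat). norm (A ** B) \<le> norm A * norm B * C"
    using bounded_bilinear.pos_bounded[OF bounded_bilinear_mult] by blast
  show ?thesis
  proof (rule that[of "1 / C"])
    fix K :: "'n cmat" assume K: "hermitian K" "norm K < 1 / C" "mat 1 + K \<in> unitary_group"
    \<comment> \<open>A Hermitian unitary is an involution; hence \<open>2 K\<close> equals minus
      the square of \<open>K\<close>, which forces a small \<open>K\<close> to vanish.\<close>
    have "(mat 1 + K) ** (mat 1 + K) = mat 1"
      using unitary_groupD(1)[OF K(3)] K(1) by (simp add: hermitian_def adjoint_add)
    then have "2 *\<^sub>R K = - (K ** K)"
      by (simp add: matrix_add_ldistrib matrix_add_rdistrib scaleR_2 eq_neg_iff_add_eq_0 add.assoc)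
    then have "2 * norm K = norm (K ** K)"
      by (metis norm_minus_cancel norm_scaleR abs_numeral)
    also have "\<dots> \<le> norm K * norm K * C" by (rule C(2))
    also have "\<dots> \<le> norm K * 1"
      using K(2) C(1) by (simp only: mult.assoc, intro mult_left_mono) (auto simp: field_simps)
    finally show "K = 0" by simp
  qed (use C in simp)
qed

text \<open>\<open>f\<close> multiplies a Hermitian factor with conjugated evolutions and has the
  identity as derivative at 0. Its approximation \<open>h\<close>, with reachable operators in place
  of the evolutions, still covers a ball by Brouwer, and at unitary values the Hermitian factor is
  trivial.\<close>

lemma ex_ball_Jset:
  fixes H1 H2 :: "'n::finite cmat"
  assumes H: "hermitian H1" "hermitian H2" and rank: "rank_cond H1 H2"
  obtains r m where "r > 0" "\<forall>U\<in>unitary_group. norm (U - mat 1) < r \<longrightarrow> U \<in> Jset m H1 H2"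
proof -
  let ?G = "reach_conj H1 H2"
  have G_herm: "hermitian X" if "X \<in> ?G" for X
    using that H by (auto simp: reach_conj_def hermitian_def adjoint_mult matrix_mul_assoc)
  \<comment> \<open>A real basis of the Hermitian operators made of conjugated generators; each
    member will contribute one factor.\<close>
  obtain B where B: "B \<subseteq> ?G" "independent B" "?G \<subseteq> span B"
    by (rule maximal_independent_subset)
  have finB: "finite B" using B(2) by (rule finiteI_independent)
  then obtain bs where bs: "set bs = B" "distinct bs"
    using finite_distinct_list by blast
  have herm_span: "X \<in> span B" if "hermitian X" for X
    using hermitian_mem_span[OF G_herm csubspace_hull_reach_conj[OF H rank] that]
      span_minimal[OF B(3) subspace_span] by blast
  have "\<exists>P K. P \<in> reach H1 H2 \<and> K \<in> {H1, H2} \<and> b = adjoint P ** K ** P" if "b \<in> B" for b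
    using subsetD[OF B(1) that] unfolding reach_conj_def by blast
  then obtain P K where PK: "\<And>b. b \<in> B \<Longrightarrow> P b \<in> reach H1 H2" "\<And>b. b \<in> B \<Longrightarrow> K b \<in> {H1, H2}"
    "\<And>b. b \<in> B \<Longrightarrow> b = adjoint (P b) ** K b ** P b"
    by metis
  have K_herm: "hermitian (K b)" if "b \<in> B" for b
    using PK(2)[OF that] H by auto
  define re :: "'n cmat \<Rightarrow> 'n cmat" where "re X = (1 / 2) *\<^sub>R (X + adjoint X)" for X
  define im :: "'n cmat \<Rightarrow> 'n cmat" where "im X = cscale (- \<i> / 2) (X - adjoint X)" for X
  have re_herm: "hermitian (re X)" for X
    by (simp add: re_def hermitian_def adjoint_add add.commute)
  have im_herm: "hermitian (im X)" for X
    by (simp add: im_def hermitian_def vec_eq_iff algebra_simps)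
  have decomp: "re X + cscale \<i> (im X) = X" for X
    by (simp add: re_def im_def vec_eq_iff algebra_simps scaleR_conv_of_real[where 'a = complex] flip: distrib_left)
  have lin_re: "linear re"
    by (rule linearI) (simp_all add: re_def adjoint_add algebra_simps)
  have im_add: "im (X + Y) = im X + im Y" and im_scaleR: "im (c *\<^sub>R X) = c *\<^sub>R im X" for X Y c
    by (simp_all add: im_def adjoint_add cscale_add cscale_diff cscale_scaleR scaleR_diff_right)
  define \<psi> where "\<psi> b X = representation B (im X) b" for b X
  have lin_\<psi>: "linear (\<psi> b)" for b
    by (rule linearI) (simp_all add: \<psi>_def im_add im_scaleR representation_add[OF B(2)]
        representation_scale[OF B(2)] herm_span im_herm)
  have bl_\<psi>: "bounded_linear (\<psi> b)" for b
    using lin_\<psi> by (simp add: linear_conv_bounded_linear)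
  have \<psi>_sum: "(\<Sum>b\<in>B. \<psi> b X *\<^sub>R b) = im X" for X
    unfolding \<psi>_def by (rule sum_representation_eq[OF B(2) herm_span[OF im_herm] finB]) simp
  \<comment> \<open>The sign of the time compensates the minus sign in the derivative of
    \<open>evol\<close>, so that the direction is \<open>cscale \<i>\<close> of the coordinate times
    \<open>b\<close>.\<close>
  define factor where "factor b X = adjoint (P b) ** evol (K b) (- \<psi> b X) ** P b" for b X
  have \<psi>0: "\<psi> b 0 = 0" for b using lin_\<psi> by (rule linear_0)
  have re0: "re 0 = 0" using lin_re by (rule linear_0)
  have P_unitary: "P b \<in> unitary_group" if "b \<in> B" for b
    using reach_unitary[OF H PK(1)[OF that]] .
  have factor0: "factor b 0 = mat 1" if "b \<in> B" for b
    using unitary_groupD[OF P_unitary[OF that]] by (simp add: factor_def \<psi>0)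
  have factor_deriv: "(factor b has_derivative (\<lambda>X. cscale \<i> (\<psi> b X *\<^sub>R b))) (at 0)" if b: "b \<in> B" for b
  proof -
    have 1: "((\<lambda>X. - \<psi> b X) has_derivative (\<lambda>X. - \<psi> b X)) (at 0)"
      using bl_\<psi> by (intro has_derivative_minus bounded_linear_imp_has_derivative)
    have 2: "(evol (K b) has_derivative (\<lambda>t. t *\<^sub>R cscale (- \<i>) (K b))) (at (- \<psi> b 0))"
      using evol_has_vector_derivative[of "K b" 0] by (simp add: has_vector_derivative_def \<psi>0)
    have 3: "((\<lambda>X. evol (K b) (- \<psi> b X)) has_derivative (\<lambda>X. (- \<psi> b X) *\<^sub>R cscale (- \<i>) (K b))) (at 0)"
      using has_derivative_compose[OF 1 2] .
    have "bounded_linear (\<lambda>Y. adjoint (P b) ** Y ** P b)"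
      by (simp add: linear_conv_bounded_linear[symmetric] linearI matrix_add_ldistrib matrix_add_rdistrib)
    from bounded_linear.has_derivative[OF this 3]
    have "(factor b has_derivative (\<lambda>X. adjoint (P b) ** ((- \<psi> b X) *\<^sub>R cscale (- \<i>) (K b)) ** P b)) (at 0)"
      by (simp only: factor_def[abs_def])
    also have "(\<lambda>X. adjoint (P b) ** ((- \<psi> b X) *\<^sub>R cscale (- \<i>) (K b)) ** P b) =
        (\<lambda>X. cscale \<i> (\<psi> b X *\<^sub>R (adjoint (P b) ** K b ** P b)))"
      by (simp add: cscale_scaleR)
    finally show ?thesis by (simp only: PK(3)[OF b, symmetric])
  qed
  define f where "f X = (mat 1 + re X) ** lprod (\<lambda>b. factor b X) bs" for X
  have lprod0: "lprod (\<lambda>b. factor b 0) bs = mat 1"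
    using factor0 bs(1) by (intro lprod_one) simp
  have f0: "f 0 = mat 1" by (simp add: f_def lprod0 re0)
  have f_deriv: "(f has_derivative (\<lambda>X. X)) (at 0)"
  proof -
    have 1: "((\<lambda>X. mat 1 + re X) has_derivative re) (at 0)"
      using has_derivative_add[OF has_derivative_const bounded_linear_imp_has_derivative] lin_re
      by (fastforce simp: linear_conv_bounded_linear)
    have 2: "((\<lambda>X. lprod (\<lambda>b. factor b X) bs) has_derivative (\<lambda>X. \<Sum>b\<leftarrow>bs. cscale \<i> (\<psi> b X *\<^sub>R b))) (at 0)"
      using bs(1) factor_deriv factor0 by (intro lprod_has_derivative) auto
    have sum: "(\<Sum>b\<leftarrow>bs. cscale \<i> (\<psi> b X *\<^sub>R b)) = cscale \<i> (im X)" for X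
      using bs \<psi>_sum[of X, symmetric] by (simp add: sum_list_distinct_conv_sum_set cscale_sum)
    show ?thesis
      using bounded_bilinear.FDERIV[OF bounded_bilinear_mult 1 2]
      by (simp add: f_def[abs_def] lprod0 re0 sum add.commute[of "cscale _ _"] decomp)
  qed
  \<comment> \<open>Coordinates at most 1 will keep the times \<open>1 - \<psi> b X\<close>
    nonnegative.\<close>
  obtain e where e: "e > 0" "\<And>b X. b \<in> B \<Longrightarrow> norm X < e \<Longrightarrow> \<psi> b X \<le> 1"
  proof -
    have "\<forall>\<^sub>F X in at 0. \<forall>b\<in>B. \<psi> b X < 1"
    proof (rule eventually_ball_finite[OF finB], rule ballI)
      fix b
      have "((\<lambda>X. \<psi> b X) \<longlongrightarrow> \<psi> b 0) (at 0)"
        by (rule bounded_linear.tendsto[OF bl_\<psi> tendsto_ident_at])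
      then show "\<forall>\<^sub>F X in at 0. \<psi> b X < 1"
        by (rule order_tendstoD) (simp add: \<psi>0)
    qed
    then obtain e where "e > 0" "\<And>X. X \<noteq> 0 \<Longrightarrow> norm X < e \<Longrightarrow> \<forall>b\<in>B. \<psi> b X < 1"
      by (auto simp: eventually_at)
    then show ?thesis using that[of e] \<psi>0 by (metis less_eq_real_def zero_le_one)
  qed
  obtain r0 where r0: "r0 > 0"
    "\<And>K :: 'n cmat. \<lbrakk>hermitian K; norm K < r0; mat 1 + K \<in> unitary_group\<rbrakk> \<Longrightarrow> K = 0"
    using small_hermitian_unitary by blast
  have "min e r0 > 0" using e(1) r0(1) by simp
  then obtain d where d: "0 < d" "d < min e r0"
    and cover: "\<forall>h. continuous_on (cball 0 d) h \<longrightarrow> (\<forall>X\<in>cball 0 d. norm (h X - f X) \<le> d / 4)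
      \<longrightarrow> cball (f 0) (d / 4) \<subseteq> h ` cball 0 d"
    by (rule perturbed_local_surjection[OF f_deriv])
  have norm_re: "norm (re X) \<le> norm X" for X
  proof -
    have "norm (adjoint X) = norm X"
    proof -
      have "inner (adjoint X) (adjoint X) = inner X X"
        by (simp add: inner_cmat, subst sum.swap) (simp add: mult.commute)
      then show ?thesis by (simp add: norm_eq_sqrt_inner)
    qed
    then show ?thesis using norm_triangle_ineq[of X "adjoint X"] by (simp add: re_def)
  qed
  obtain C where C: "C > 0" "\<And>(X :: 'n cmat) (Y :: 'n cmat). norm (X ** Y) \<le> norm X * norm Y * C"
    using bounded_bilinear.pos_bounded[OF bounded_bilinear_mult] by blast
  define D where "D = (norm (mat 1 :: 'n cmat) + d) * C"
  have D: "D \<ge> 0" using d C by (simp add: D_def)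
  \<comment> \<open>An error \<open>\<epsilon>\<close> per factor, summed over the list and
    multiplied by the bound \<open>D\<close> for the Hermitian factor, is at most
    \<open>d / 4\<close>; the added 1 keeps the denominator positive.\<close>
  define \<epsilon> where "\<epsilon> = d / (4 * (D * length bs + 1))"
  have pos: "D * length bs + 1 > 0" using D by (simp add: add_nonneg_pos)
  have \<epsilon>: "\<epsilon> > 0" "D * (length bs * \<epsilon>) \<le> d / 4"
    using pos d D by (simp_all add: \<epsilon>_def field_simps)
  \<comment> \<open>The inverse of \<open>P b\<close> is approximated together with a unit of
    backward time, so that the compensating time \<open>1 - \<psi> b X\<close> runs forward even
    when \<open>- \<psi> b X\<close> is negative.\<close>
  have "\<exists>Q. Q \<in> reach H1 H2 \<and> norm (Q - adjoint (evol (K b) 1 ** P b)) < \<epsilon>" if "b \<in> B" for b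
  proof -
    have "evol (K b) 1 ** P b \<in> reach H1 H2"
      by (intro reach_mult reach_evol PK that) simp
    then show ?thesis using reach_near_adjoint[OF H _ \<epsilon>(1)] by blast
  qed
  then obtain Q where Q: "\<And>b. b \<in> B \<Longrightarrow> Q b \<in> reach H1 H2"
    "\<And>b. b \<in> B \<Longrightarrow> norm (Q b - adjoint (evol (K b) 1 ** P b)) < \<epsilon>"
    by metis
  define factor' where "factor' b X = Q b ** evol (K b) (1 - \<psi> b X) ** P b" for b X
  define h where "h X = (mat 1 + re X) ** lprod (\<lambda>b. factor' b X) bs" for X
  have unitary: "factor b X \<in> unitary_group" "factor' b X \<in> unitary_group" if "b \<in> B" for b X
    unfolding factor_def factor'_def
    by (intro unitary_mult unitary_adjoint P_unitary evol_unitary K_herm reach_unitary[OF H Q(1)] that)+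
  have "norm (factor' b X - factor b X) \<le> \<epsilon>" if b: "b \<in> B" for b X
  proof -
    have "factor b X = adjoint (evol (K b) 1 ** P b) ** evol (K b) (1 - \<psi> b X) ** P b"
    proof -
      have "evol (K b) (- \<psi> b X) = evol (K b) (- 1) ** evol (K b) (1 - \<psi> b X)"
        by (simp add: evol_add[symmetric])
      then show ?thesis
        by (simp add: factor_def adjoint_mult adjoint_evol[OF K_herm[OF b]] matrix_mul_assoc)
    qed
    then have "factor' b X - factor b X =
        (Q b - adjoint (evol (K b) 1 ** P b)) ** evol (K b) (1 - \<psi> b X) ** P b"
      by (simp add: factor'_def mult_diff_left)
    then have "norm (factor' b X - factor b X) = norm (Q b - adjoint (evol (K b) 1 ** P b))"
      by (simp add: norm_unitary_mult(2)[OF P_unitary[OF b]] norm_unitary_mult(2)[OF evol_unitary[OF K_herm[OF b]]])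
    then show ?thesis using Q(2)[OF b] by simp
  qed
  then have lprod_close: "norm (lprod (\<lambda>b. factor' b X) bs - lprod (\<lambda>b. factor b X) bs) \<le> length bs * \<epsilon>" for X
    using unitary bs(1) by (intro lprod_diff_bound) auto
  have close: "norm (h X - f X) \<le> d / 4" if X: "X \<in> cball 0 d" for X
  proof -
    have "norm (h X - f X) = norm ((mat 1 + re X) ** (lprod (\<lambda>b. factor' b X) bs - lprod (\<lambda>b. factor b X) bs))"
      by (simp add: h_def f_def mult_diff_right)
    also have "\<dots> \<le> norm (mat 1 + re X) * norm (lprod (\<lambda>b. factor' b X) bs - lprod (\<lambda>b. factor b X) bs) * C"
      by (rule C(2))
    also have "\<dots> \<le> (norm (mat 1 :: 'n cmat) + d) * (length bs * \<epsilon>) * C"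
    proof (intro mult_right_mono mult_mono lprod_close)
      show "norm (mat 1 + re X) \<le> norm (mat 1 :: 'n cmat) + d"
        using norm_triangle_ineq[of "mat 1" "re X"] norm_re[of X] X by simp
    qed (use C d in auto)
    also have "\<dots> = D * (length bs * \<epsilon>)" by (simp add: D_def)
    finally show ?thesis using \<epsilon>(2) by simp
  qed
  have "continuous_on (cball 0 d) h"
    unfolding h_def factor'_def
    by (intro continuous_intros lprod_continuous_on linear_continuous_on bl_\<psi>)
      (use lin_re in \<open>auto simp: linear_conv_bounded_linear\<close>)
  then have covered: "cball (mat 1) (d / 4) \<subseteq> h ` cball 0 d"
    using cover close f0 by (metis (no_types, lifting))
  have "\<exists>m. \<forall>X\<in>cball 0 d. factor' b X \<in> Jset m H1 H2" if "b \<in> set bs" for b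
  proof -
    have b: "b \<in> B" using that bs by simp
    obtain p where p: "P b \<in> Jset p H1 H2" using PK(1)[OF b] by (auto simp: reach_def)
    obtain q where q: "Q b \<in> Jset q H1 H2" using Q(1)[OF b] by (auto simp: reach_def)
    have "factor' b X \<in> Jset (p + 2 + 2 * q) H1 H2" if "X \<in> cball 0 d" for X
    proof -
      have "\<psi> b X \<le> 1" using e(2)[OF b, of X] that d(2) by simp
      then have "evol (K b) (1 - \<psi> b X) ** P b \<in> Jset (p + 2) H1 H2"
        using evol_mult_Jset[OF _ p PK(2)[OF b]] by simp
      from Jset_mult[OF this q] show ?thesis by (simp add: factor'_def matrix_mul_assoc)
    qed
    then show ?thesis by blast
  qed
  then obtain m where m: "\<forall>X\<in>cball 0 d. lprod (\<lambda>b. factor' b X) bs \<in> Jset m H1 H2"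
    using lprod_Jset[of bs "cball 0 d" factor' H1 H2] by blast
  show ?thesis
  proof (rule that[of "d / 4" m])
    show "d / 4 > 0" using d by simp
    show "\<forall>U\<in>unitary_group. norm (U - mat 1) < d / 4 \<longrightarrow> U \<in> Jset m H1 H2"
    proof (intro ballI impI)
      fix U :: "'n cmat" assume U: "U \<in> unitary_group" "norm (U - mat 1) < d / 4"
      then have "U \<in> cball (mat 1) (d / 4)" by (simp add: dist_norm norm_minus_commute)
      then obtain X where X: "X \<in> cball 0 d" "U = h X" using covered by blast
      define g where "g = lprod (\<lambda>b. factor' b X) bs"
      have g: "g \<in> unitary_group" unfolding g_def using unitary(2) bs(1) by (intro lprod_unitary) simp
      have "U = (mat 1 + re X) ** g" by (simp add: X(2) h_def g_def)
      \<comment> \<open>The Hermitian factor is a quotient of unitaries, hence unitary, and its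
        smallness makes it the identity.\<close>
      then have "mat 1 + re X = U ** adjoint g" by (simp add: unitary_cancel[OF g])
      then have "mat 1 + re X \<in> unitary_group" using U(1) g by (simp add: unitary_mult unitary_adjoint)
      moreover have "norm (re X) < r0" using norm_re[of X] X(1) d(2) by simp
      ultimately have "re X = 0" using r0(2)[OF re_herm] by blast
      then have "U = g" using \<open>U = (mat 1 + re X) ** g\<close> by simp
      then show "U \<in> Jset m H1 H2" using m X(1) by (simp add: g_def)
    qed
  qed
qed

section \<open>From a neighbourhood of the identity to the whole group\<close>

lemma inner_one_mult: "inner (mat 1) (A ** B) = inner (adjoint A) B" for A B :: "'n::finite cmat"
  using inner_mult_left[of "adjoint A" "mat 1" B] by simp

text \<open>Every coset of the reachable set meets the identity: a point of the coset nearest to the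
  identity is a Hermitian unitary, and such a \<open>V\<close> lies on the one-parameter group
  \<open>(1 + V) / 2 + exp (i \<theta>) (1 - V) / 2\<close>.\<close>
lemma reach_eq_unitary_group:
  fixes H1 H2 :: "'n::finite cmat"
  assumes H: "hermitian H1" "hermitian H2" and r: "r > 0"
    and ball: "\<And>U. U \<in> unitary_group \<Longrightarrow> norm (U - mat 1) < r \<Longrightarrow> U \<in> reach H1 H2"
  shows "reach H1 H2 = unitary_group"
proof
  let ?R = "reach H1 H2"
  show sub: "?R \<subseteq> unitary_group" using reach_unitary[OF H] by blast
  \<comment> \<open>Translation gives every reachable point a neighbourhood of the same radius
    \<open>r\<close>; the uniform radius also makes the reachable set closed.\<close>
  have near: "U \<in> ?R" if "V \<in> ?R" "U \<in> unitary_group" "norm (U - V) < r" for U V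
  proof -
    have V: "V \<in> unitary_group" using sub that(1) by blast
    have "norm (adjoint V ** U - mat 1) = norm (V ** (adjoint V ** U - mat 1))"
      using V by simp
    also have "V ** (adjoint V ** U - mat 1) = U - V"
      by (simp add: mult_diff_right unitary_cancel[OF V])
    finally have "adjoint V ** U \<in> ?R"
      using that V by (intro ball) (simp_all add: unitary_mult unitary_adjoint)
    then have "V ** (adjoint V ** U) \<in> ?R" by (rule reach_mult[OF that(1)])
    then show ?thesis by (simp add: unitary_cancel[OF V])
  qed
  have near_closure: "U \<in> ?R" if U: "U \<in> closure ?R" for U
  proof -
    have "U \<in> unitary_group" using closure_minimal[OF sub closed_unitary_group] U by blast
    moreover obtain V where "V \<in> ?R" "dist V U < r"
      using U r by (auto simp: closure_approachable)
    ultimately show ?thesis using near[of V U] by (simp add: dist_norm norm_minus_commute)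
  qed
  then have "closed ?R" using closure_subset_eq[of ?R] by blast
  then have compact: "compact ?R"
    using compact_Int_closed[OF compact_unitary_group, of ?R] sub by (simp add: Int_absorb1)
  have adj: "adjoint V \<in> ?R" if V: "V \<in> ?R" for V
  proof (rule near_closure, unfold closure_approachable, intro allI impI)
    fix e :: real assume "e > 0"
    then obtain Q where "Q \<in> ?R" "norm (Q - adjoint V) < e"
      by (rule reach_near_adjoint[OF H V])
    then show "\<exists>Q\<in>?R. dist Q (adjoint V) < e" by (auto simp: dist_norm)
  qed
  show "unitary_group \<subseteq> ?R"
  proof
    fix U :: "'n cmat" assume U: "U \<in> unitary_group"
    have "?R \<noteq> {}" using reach_one by blast
    \<comment> \<open>All unitaries have the same norm, so maximizing this inner product minimizes
      the distance from \<open>U ** g\<close> to the identity.\<close>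
    moreover have "continuous_on ?R (\<lambda>g. inner (mat 1) (U ** g))"
      by (intro continuous_intros)
    ultimately obtain g where g: "g \<in> ?R"
      and max: "\<forall>g'\<in>?R. inner (mat 1) (U ** g') \<le> inner (mat 1) (U ** g)"
      using continuous_attains_sup[OF compact] by blast
    define V where "V = U ** g"
    have gU: "g \<in> unitary_group" using sub g by blast
    have V: "V \<in> unitary_group" unfolding V_def using U gU by (rule unitary_mult)
    \<comment> \<open>First-order condition at the maximum: for small \<open>t\<close> of either
      sign \<open>evol K t\<close> lies in the ball and hence is reachable.\<close>
    have crit: "inner (mat 1) (V ** cscale (- \<i>) K) = 0" if K: "hermitian K" for K
    proof -
      have "continuous_on UNIV (evol K)" using continuous_on_evol[OF continuous_on_id] by simp
      then have "isCont (evol K) 0" by (simp add: continuous_on_eq_continuous_at)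
      then obtain d where d: "d > 0" "\<And>t. \<bar>t\<bar> < d \<Longrightarrow> norm (evol K t - mat 1) < r"
        using r unfolding continuous_at_eps_delta by (auto simp: dist_norm)
      have deriv: "((\<lambda>t. inner (mat 1) (V ** evol K t)) has_real_derivative inner (mat 1) (V ** cscale (- \<i>) K)) (at 0)"
      proof -
        have "bounded_linear (\<lambda>X. inner (mat 1) (V ** X))"
          by (simp add: linear_conv_bounded_linear[symmetric] linearI matrix_add_ldistrib inner_add_right)
        from bounded_linear.has_vector_derivative[OF this evol_has_vector_derivative[of K 0]]
        show ?thesis by (simp add: has_real_derivative_iff_has_vector_derivative)
      qed
      have "\<forall>t. \<bar>0 - t\<bar> < d \<longrightarrow> inner (mat 1) (V ** evol K t) \<le> inner (mat 1) (V ** evol K 0)"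
      proof (intro allI impI)
        fix t assume "\<bar>0 - t\<bar> < d"
        then have "evol K t \<in> ?R" using d(2) evol_unitary[OF K] by (intro ball) auto
        then have "g ** evol K t \<in> ?R" by (rule reach_mult[OF g])
        from bspec[OF max this] show "inner (mat 1) (V ** evol K t) \<le> inner (mat 1) (V ** evol K 0)"
          by (simp add: V_def matrix_mul_assoc)
      qed
      then show ?thesis by (rule DERIV_local_max[OF deriv d(1)])
    qed
    have V_herm: "adjoint V = V"
    proof -
      \<comment> \<open>In this direction the first-order condition says that
        \<open>adjoint V - V\<close> has norm 0.\<close>
      have "hermitian (cscale \<i> (adjoint V - V))"
        by (simp add: hermitian_def vec_eq_iff algebra_simps)
      from crit[OF this] have "inner (mat 1) (V ** adjoint V) = inner (mat 1) (V ** V)"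
        by (simp add: mult_diff_right inner_diff_right)
      then have "inner (adjoint V) V = inner (adjoint V) (adjoint V)"
        by (simp add: inner_one_mult)
      moreover have "inner V V = inner (adjoint V) (adjoint V)"
        using inner_one_mult[of "adjoint V" V] inner_one_mult[of V "adjoint V"]
        by (simp add: unitary_groupD[OF V])
      ultimately have "inner (adjoint V - V) (adjoint V - V) = 0"
        by (simp add: inner_diff_left inner_diff_right inner_commute)
      then show ?thesis by simp
    qed
    have VV: "V ** V = mat 1" using unitary_groupD(1)[OF V] V_herm by simp
    \<comment> \<open>Half of \<open>S\<close> and half of \<open>T\<close> are the spectral
      projections of the involution \<open>V\<close> for the eigenvalues 1 and -1; \<open>W\<close>
      rotates the phase of the second and reaches \<open>V\<close> at the angle
      \<open>pi\<close>.\<close>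
    define S T where "S = mat 1 + V" and "T = mat 1 - V"
    define W where "W \<theta> = cscale (1 / 2) S + cscale (cis \<theta> / 2) T" for \<theta>
    note W = W_def S_def T_def
    have W_add: "W a ** W b = W (a + b)" for a b
    proof -
      have "S ** S = cscale 2 S" "T ** T = cscale 2 T" "S ** T = 0" "T ** S = 0"
        by (simp_all add: S_def T_def matrix_add_ldistrib matrix_add_rdistrib mult_diff_left
            mult_diff_right VV cscale_add cscale_diff cscale_add_left[of 1 1, simplified])
      then show ?thesis
        by (simp add: W_def matrix_add_ldistrib matrix_add_rdistrib cis_mult[symmetric] mult.commute)
    qed
    have W0: "W 0 = mat 1"
      by (simp add: W vec_eq_iff algebra_simps flip: distrib_left)
    have "W pi = V"
      by (simp add: W vec_eq_iff algebra_simps flip: distrib_left)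
    have "adjoint (W \<theta>) = W (- \<theta>)" for \<theta>
      by (simp add: W adjoint_add adjoint_diff V_herm cis_cnj)
    then have W_unitary: "W \<theta> \<in> unitary_group" for \<theta>
      by (simp add: unitary_group_def W_add W0)
    have W_mpow: "mpow (W \<theta>) k = W (real k * \<theta>)" for \<theta> k
      by (induction k) (simp_all add: W0 W_add algebra_simps)
    \<comment> \<open>A small enough fraction of the angle gives an operator in the ball, and a
      power of it is \<open>V\<close>.\<close>
    have "(\<lambda>k. pi / real (Suc k)) \<longlonglongrightarrow> 0"
      using tendsto_mult[OF tendsto_const[of pi] LIMSEQ_inverse_real_of_nat] by (simp add: divide_inverse)
    then have "(\<lambda>k. cis (pi / real (Suc k))) \<longlonglongrightarrow> cis 0"
      by (rule tendsto_cis)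
    then have "(\<lambda>k. 1 / 2 * S $ i $ j + cis (pi / real (Suc k)) / 2 * T $ i $ j)
        \<longlonglongrightarrow> 1 / 2 * S $ i $ j + cis 0 / 2 * T $ i $ j" for i j
      by (intro tendsto_add tendsto_mult tendsto_divide tendsto_const) simp_all
    then have "(\<lambda>k. W (pi / real (Suc k))) \<longlonglongrightarrow> W 0"
      by (intro vec_tendstoI) (simp only: W_def vector_add_component cscale_nth)
    then obtain k where "dist (W (pi / real (Suc k))) (W 0) < r"
      using r by (meson metric_LIMSEQ_D order_refl)
    then have "W (pi / real (Suc k)) \<in> ?R"
      by (intro ball W_unitary) (simp add: dist_norm W0)
    then have "mpow (W (pi / real (Suc k))) (Suc k) \<in> ?R" by (rule reach_mpow)
    then have "V \<in> ?R" by (simp add: W_mpow \<open>W pi = V\<close> del: mpow.simps of_nat_Suc)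
    then have "V ** adjoint g \<in> ?R" using adj[OF g] by (rule reach_mult)
    then show "U \<in> ?R" by (simp add: V_def unitary_cancel[OF gU])
  qed
qed

lemma rank_cond_imp_controllable:
  fixes H1 H2 :: "'n::finite cmat"
  assumes H: "hermitian H1" "hermitian H2" and rank: "rank_cond H1 H2"
  shows "U_controllable H1 H2"
proof -
  obtain r m where r: "r > 0"
    and ball: "\<forall>U\<in>unitary_group. norm (U - mat 1) < r \<longrightarrow> U \<in> Jset m H1 H2"
    by (rule ex_ball_Jset[OF H rank])
  have reach: "reach H1 H2 = unitary_group"
    by (rule reach_eq_unitary_group[OF H r]) (use ball in \<open>auto simp: reach_def\<close>)
  have "\<exists>C\<subseteq>reach H1 H2. finite C \<and> unitary_group \<subseteq> (\<Union>g\<in>C. ball g r)"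
    by (rule compactE_image[OF compact_unitary_group, of "reach H1 H2" "\<lambda>g. ball g r"])
      (use r in \<open>auto simp: reach\<close>)
  then obtain C where C: "C \<subseteq> reach H1 H2" "finite C"
    "unitary_group \<subseteq> (\<Union>g\<in>C. ball g r)" by blast
  have "\<forall>g\<in>C. \<exists>n. g \<in> Jset n H1 H2" using C(1) by (auto simp: reach_def)
  then obtain len where len: "\<And>g. g \<in> C \<Longrightarrow> g \<in> Jset (len g) H1 H2" by metis
  \<comment> \<open>The sum dominates the length needed for each centre \<open>g\<close>, and
    \<open>Suc\<close> makes it at least 1.\<close>
  define n where "n = Suc (\<Sum>g\<in>C. m + 2 * len g)"
  have "unitary_group \<subseteq> Jset n H1 H2"
  proof
    fix U :: "'n cmat" assume U: "U \<in> unitary_group"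
    then obtain g where g: "g \<in> C" "norm (U - g) < r"
      using C(3) by (auto simp: dist_norm norm_minus_commute)
    have gU: "g \<in> unitary_group" using C(1) g(1) reach by blast
    have "norm (adjoint g ** U - mat 1) = norm (g ** (adjoint g ** U - mat 1))"
      using gU by simp
    also have "g ** (adjoint g ** U - mat 1) = U - g"
      by (simp add: mult_diff_right unitary_cancel[OF gU])
    finally have "adjoint g ** U \<in> Jset m H1 H2"
      using g U gU ball by (simp add: unitary_mult unitary_adjoint)
    from Jset_mult[OF this len[OF g(1)]] have "U \<in> Jset (m + 2 * len g) H1 H2"
      by (simp add: unitary_cancel[OF gU])
    moreover have "m + 2 * len g \<le> n"
      unfolding n_def using member_le_sum[of g C "\<lambda>g. m + 2 * len g"] g(1) C(2) by simp
    ultimately show "U \<in> Jset n H1 H2" by (intro Jset_mono[of _ n])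
  qed
  then have "Jset n H1 H2 = unitary_group" using Jset_unitary[OF H] by blast
  then show ?thesis unfolding U_controllable_def by (intro exI[of _ n]) (simp add: n_def)
qed

section \<open>Openness and density\<close>

lemma Sigma_ctrl_iff:
  assumes "CARD('n::finite) \<ge> 2"
  shows "(H1, H2) \<in> Sigma_ctrl \<longleftrightarrow>
    hermitian H1 \<and> hermitian H2 \<and> rank_cond H1 (H2 :: 'n cmat)"
  using controllable_imp_rank_cond[OF assms] rank_cond_imp_controllable
  by (auto simp: Sigma_ctrl_def herm_ops_def)

text \<open>For each choice of words the determinant is continuous in the pair, and the set is the
  union of these nonvanishing sets.\<close>

lemma open_rank_cond: "open {(H1, H2 :: 'n::finite cmat). rank_cond H1 H2}"
proof -
  have cont: "continuous_on UNIV (\<lambda>(H1, H2 :: 'n cmat). bracket H1 H2 k w)" for k w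
  proof (induction w)
    case Nil
    then show ?case by (cases k) (auto simp: case_prod_unfold intro!: continuous_intros)
  next
    case (Cons j w)
    then show ?case
      by (cases j) (auto simp: case_prod_unfold comm_def intro!: continuous_intros)
  qed
  have "open {p. det (\<chi> q::'n \<times> 'n. flat (bracket (fst p) (snd p :: 'n cmat) (k q) (w q))) \<noteq> 0}" for k w
  proof (rule open_Collect_neq)
    have entry: "continuous_on UNIV (\<lambda>p. bracket (fst p) (snd p :: 'n cmat) k w $ i $ j)" for k w i j
      using cont[of k w] by (auto simp: case_prod_unfold intro!: continuous_intros)
    show "continuous_on UNIV (\<lambda>p. det (\<chi> q::'n \<times> 'n. flat (bracket (fst p) (snd p :: 'n cmat) (k q) (w q))))"
      unfolding det_def by (auto intro!: continuous_intros entry)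
  qed simp
  moreover have "{(H1, H2 :: 'n cmat). rank_cond H1 H2} =
      (\<Union>k. \<Union>w. {p. det (\<chi> q::'n \<times> 'n. flat (bracket (fst p) (snd p :: 'n cmat) (k q) (w q))) \<noteq> 0})"
    by (simp add: rank_cond_def case_prod_unfold set_eq_iff)
  ultimately show ?thesis by (simp add: open_UN)
qed

text \<open>Along a segment the determinant is a polynomial in the parameter.\<close>
lemma rank_cond_segment:
  fixes H1 H2 G1 G2 :: "'n::finite cmat"
  assumes "rank_cond G1 G2" "e > 0"
  obtains t :: real where "0 < t" "t < e" "rank_cond (H1 + t *\<^sub>R (G1 - H1)) (H2 + t *\<^sub>R (G2 - H2))"
proof -
  \<comment> \<open>A complex parameter makes the entries complex polynomials; the real segment is
    recovered through \<open>of_real\<close>.\<close>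
  define A where "A t = H1 + cscale t (G1 - H1)" for t
  define B where "B t = H2 + cscale t (G2 - H2)" for t
  have lin: "\<exists>p. \<forall>t. (H + cscale t (G - H)) $ i $ j = poly p t" for H G :: "'n cmat" and i j
    by (rule exI[of _ "[:H $ i $ j, G $ i $ j - H $ i $ j:]"]) simp
  have poly_bracket: "\<exists>p. \<forall>t. bracket (A t) (B t) k w $ i $ j = poly p t" for k w i j
  proof (induction w arbitrary: i j)
    case Nil
    show ?case using lin by (cases k) (simp_all add: A_def B_def)
  next
    case (Cons l w)
    obtain p where p: "\<And>i j t. bracket (A t) (B t) k w $ i $ j = poly (p i j) t"
      using Cons by metis
    obtain q where q: "\<And>i j t. (if l then A t else B t) $ i $ j = poly (q i j) t"
    proof -
      have "\<exists>q. \<forall>t. (if l then A t else B t) $ i $ j = poly q t" for i j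
        using lin by (cases l) (simp_all add: A_def B_def)
      then show ?thesis using that by metis
    qed
    have "bracket (A t) (B t) k (l # w) $ i $ j =
        poly (\<Sum>m\<in>UNIV. q i m * p m j) t - poly (\<Sum>m\<in>UNIV. p i m * q m j) t" for t
      by (simp only: bracket.simps comm_def vector_minus_component matrix_matrix_mult_def vec_lambda_beta p q
          poly_sum poly_mult)
    then show ?case
      by (intro exI[of _ "(\<Sum>m\<in>UNIV. q i m * p m j) - (\<Sum>m\<in>UNIV. p i m * q m j)"]) simp
  qed
  obtain k w where kw: "det (\<chi> q::'n \<times> 'n. flat (bracket G1 G2 (k q) (w q))) \<noteq> 0"
    using assms(1) by (auto simp: rank_cond_def)
  obtain p where p: "\<And>q i j t. bracket (A t) (B t) (k q) (w q) $ i $ j = poly (p q i j) t"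
  proof -
    have "\<exists>p. \<forall>t. bracket (A t) (B t) (k q) (w q) $ i $ j = poly p t" for q i j
      by (rule poly_bracket)
    then show ?thesis using that by metis
  qed
  define P where "P = (\<Sum>\<pi>\<in>{\<pi>. \<pi> permutes UNIV}. of_int (sign \<pi>) *
    (\<Prod>q\<in>(UNIV :: ('n \<times> 'n) set). p q (fst (\<pi> q)) (snd (\<pi> q))))"
  have P: "det (\<chi> q::'n \<times> 'n. flat (bracket (A t) (B t) (k q) (w q))) = poly P t" for t
    by (simp add: det_def P_def p poly_sum poly_prod)
  \<comment> \<open>At parameter 1 the segment ends in \<open>(G1, G2)\<close>, where the
    determinant does not vanish; so \<open>P\<close> has finitely many roots.\<close>
  have "poly P 1 \<noteq> 0"
    using kw P[of 1] by (simp add: A_def B_def)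
  then have "P \<noteq> 0" by auto
  then have "finite {t. poly P t = 0}" by (rule poly_roots_finite)
  then have "finite (of_real -` {t. poly P t = 0} :: real set)"
    by (rule finite_vimageI) (simp add: inj_of_real)
  moreover have "infinite {0<..<e}" using \<open>e > 0\<close> by simp
  ultimately obtain t where t: "t \<in> {0<..<e}" "poly P (of_real t) \<noteq> 0"
    by (metis (mono_tags, lifting) finite_subset mem_Collect_eq subsetI vimageI)
  have "rank_cond (A t) (B t)"
    using t(2) unfolding rank_cond_def P[symmetric] by blast
  then show ?thesis
    using t(1) that[of t] by (simp add: A_def B_def scaleR_eq_cscale)
qed

section \<open>Density along segments\<close>

lemma hermitian_segment:
  assumes "hermitian H" "hermitian G"
  shows "hermitian (H + t *\<^sub>R (G - H))"
  using assms by (simp add: hermitian_def adjoint_add adjoint_diff)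

lemma segment_closure:
  fixes x y :: "'a::real_normed_vector"
  assumes "\<And>e::real. e > 0 \<Longrightarrow> \<exists>t. 0 < t \<and> t < e \<and> x + t *\<^sub>R y \<in> S"
  shows "x \<in> closure S"
  unfolding closure_approachable
proof (intro allI impI)
  fix e :: real assume "e > 0"
  then obtain t where t: "0 < t" "t < e / (norm y + 1)" "x + t *\<^sub>R y \<in> S"
    using assms[of "e / (norm y + 1)"] by (auto simp: add_nonneg_pos)
  have "norm (t *\<^sub>R y) \<le> t * (norm y + 1)" using t(1) by (simp add: mult_left_mono)
  also have "\<dots> < e" using t(2) by (simp add: pos_less_divide_eq add_nonneg_pos)
  finally show "\<exists>s\<in>S. dist s x < e" using t(3) by (intro bexI[of _ "x + t *\<^sub>R y"]) (simp_all add: dist_norm)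
qed

text \<open>One completing operator suffices: segments towards it with \<open>H1\<close> held fixed
  give density. Conversely a dense subset of the nonempty space of Hermitian operators is
  nonempty.\<close>

lemma almost_U_controllable_iff:
  fixes H1 :: "'n::finite cmat"
  assumes N: "CARD('n) \<ge> 2" and H1: "hermitian H1"
  shows "almost_U_controllable H1 \<longleftrightarrow> (\<exists>H2. hermitian H2 \<and> rank_cond H1 H2)"
proof
  have Sigma_of: "Sigma_of H1 = {H2. hermitian H2 \<and> rank_cond H1 H2}"
    using Sigma_ctrl_iff[OF N] H1 by (auto simp: Sigma_of_def herm_ops_def)
  assume "almost_U_controllable H1"
  then have "Sigma_of H1 \<noteq> {}"
    using adjoint_zero by (auto simp: almost_U_controllable_def herm_ops_def hermitian_def simp del: adjoint_zero)
  then show "\<exists>H2. hermitian H2 \<and> rank_cond H1 H2" by (auto simp: Sigma_of)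
next
  have Sigma_of: "Sigma_of H1 = {H2. hermitian H2 \<and> rank_cond H1 H2}"
    using Sigma_ctrl_iff[OF N] H1 by (auto simp: Sigma_of_def herm_ops_def)
  assume "\<exists>H2. hermitian H2 \<and> rank_cond H1 H2"
  then obtain G where G: "hermitian G" "rank_cond H1 G" by blast
  have "open (Pair H1 -` {(H1, H2). rank_cond H1 H2})"
    by (intro open_vimage open_rank_cond continuous_intros)
  moreover have "Sigma_of H1 = herm_ops \<inter> Pair H1 -` {(H1, H2). rank_cond H1 H2}"
    by (auto simp: Sigma_of herm_ops_def)
  ultimately have "openin (top_of_set herm_ops) (Sigma_of H1)"
    by (auto simp: openin_open)
  moreover have "H2 \<in> closure (Sigma_of H1)" if "hermitian H2" for H2
  proof (rule segment_closure[of _ "G - H2"])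
    fix e :: real assume "e > 0"
    then obtain t where "0 < t" "t < e" "rank_cond (H1 + t *\<^sub>R (H1 - H1)) (H2 + t *\<^sub>R (G - H2))"
      by (rule rank_cond_segment[OF G(2)])
    then show "\<exists>t. 0 < t \<and> t < e \<and> H2 + t *\<^sub>R (G - H2) \<in> Sigma_of H1"
      using hermitian_segment[OF that G(1), of t] by (auto simp: Sigma_of)
  qed
  ultimately show "almost_U_controllable H1"
    by (auto simp: almost_U_controllable_def herm_ops_def)
qed

theorem mainTheorem4:
  assumes "CARD('n::finite) \<ge> 2"
  shows "(openin (top_of_set (herm_ops \<times> herm_ops)) (Sigma_ctrl :: ('n cmat \<times> 'n cmat) set)
          \<and> herm_ops \<times> herm_ops \<subseteq> closure (Sigma_ctrl :: ('n cmat \<times> 'n cmat) set))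
       \<and> (openin (top_of_set herm_ops) {H1 :: 'n cmat \<in> herm_ops. almost_U_controllable H1}
          \<and> herm_ops \<subseteq> closure {H1 :: 'n cmat \<in> herm_ops. almost_U_controllable H1})"
proof -
  let ?\<Sigma> = "Sigma_ctrl :: ('n cmat \<times> 'n cmat) set"
  let ?A = "{H1 :: 'n cmat \<in> herm_ops. almost_U_controllable H1}"
  obtain D J :: "'n cmat" where DJ: "hermitian D" "hermitian J" "rank_cond D J"
    using ex_rank_cond by blast
  have Sigma: "?\<Sigma> = (herm_ops \<times> herm_ops) \<inter> {(H1, H2). rank_cond H1 H2}"
    using Sigma_ctrl_iff[OF assms] by (auto simp: herm_ops_def)
  \<comment> \<open>The projection of the controllable pairs, written as a union of slices at fixed
    \<open>H2\<close>, each cut out by an open set.\<close>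
  have A: "?A = herm_ops \<inter> (\<Union>H2\<in>herm_ops. (\<lambda>H1. (H1, H2)) -` {(H1, H2). rank_cond H1 H2})"
    using almost_U_controllable_iff[OF assms] by (auto simp: herm_ops_def)
  have segment: "\<exists>t. 0 < t \<and> t < e \<and> (H1 + t *\<^sub>R (D - H1), H2 + t *\<^sub>R (J - H2)) \<in> ?\<Sigma>"
    if "hermitian H1" "hermitian H2" "e > 0" for H1 H2 and e :: real
    using rank_cond_segment[OF DJ(3) that(3), of H1 H2] hermitian_segment that DJ(1,2)
    by (metis Sigma_ctrl_iff[OF assms])
  have "openin (top_of_set (herm_ops \<times> herm_ops)) ?\<Sigma>"
    unfolding Sigma by (intro openin_open_Int open_rank_cond)
  moreover have "p \<in> closure ?\<Sigma>" if "p \<in> herm_ops \<times> herm_ops" for p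
    using that segment by (intro segment_closure[of p "(D, J) - p"]) (auto simp: herm_ops_def)
  moreover have "openin (top_of_set herm_ops) ?A"
    unfolding A by (intro openin_open_Int open_UN ballI open_vimage open_rank_cond continuous_intros)
  moreover have "H1 \<in> closure ?A" if "H1 \<in> herm_ops" for H1
  proof (rule segment_closure[of _ "D - H1"])
    fix e :: real assume "e > 0"
    \<comment> \<open>Starting the second component at \<open>J\<close> keeps it constant, so
      \<open>J\<close> completes every such point of the segment.\<close>
    with segment[of H1 J] that DJ(2) obtain t where t: "0 < t" "t < e"
      "(H1 + t *\<^sub>R (D - H1), J + t *\<^sub>R (J - J)) \<in> ?\<Sigma>"
      by (auto simp: herm_ops_def)
    then have "H1 + t *\<^sub>R (D - H1) \<in> ?A"
      using almost_U_controllable_iff[OF assms] by (auto simp: Sigma herm_ops_def)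
    then show "\<exists>t. 0 < t \<and> t < e \<and> H1 + t *\<^sub>R (D - H1) \<in> ?A" using t by blast
  qed
  ultimately show ?thesis by blast
qed

end
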